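(* Let $p\ge5$ be a prime, $n\ge3$, $k=\mathbf F_p$, and let $T_N$, $H_a=G_{a+1}/G_N$, $\mathcal A_a(H_\bullet)$, $\mathcal I_a=\mathcal I_a^N$ and $\mathfrak D$ be as defined in the context. For every $N\ge3$, the following hold. (1) The canonical weighted filtration $$\Delta_{\mathbf Z}(T_N)=\mathcal A_1(H_\bullet)\supseteq\mathcal A_2(H_\bullet)\supseteq\cdots$$ is a multiplicative filtration (i.e. $\mathcal A_a(H_\bullet)\mathcal A_b(H_\bullet)\subseteq\mathcal A_{a+b}(H_\bullet)$) by two-sided ideals of $\mathbf Z[T_N]$, and $$\mathfrak D\bigl(\mathcal A_a(H_\bullet)\bigr)=H_a=G_{a+1}/G_N\qquad(a\ge1).$$ (2) The ideals defined by the jet action give a second multiplicative filtration $$\Delta_{\mathbf Z}(T_N)=\mathcal I_1\supseteq\mathcal I_2\supseteq\cdots$$ by two-sided ideals of $\mathbf Z[T_N]$ (with $\mathcal I_a\mathcal I_b\subseteq\mathcal I_{a+b}$) such that, for every $a\ge1$, $$\mathcal A_a(H_\bullet)\subseteq\mathcal I_a,\qquad \mathfrak D(\mathcal I_a)=G_{a+1}/G_N.$$ (3) If $N'\ge N$, the ring homomorphism $\mathbf Z[T_{N'}]\to\mathbf Z[T_N]$ induced by the quotient map $T_{N'}\to T_N$ sends $\mathcal I_a^{N'}$ into $\mathcal I_a^{N}$ for every $a\ge1$.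
   Context: Let $A=k[[x_1,\ldots,x_n]]$ with maximal ideal $\mathfrak m=(x_1,\ldots,x_n)$ and $\operatorname{vol}=dx_1\wedge\cdots\wedge dx_n$. $G$ is the group (under composition, $gh=g\circ h$) of continuous $k$-algebra automorphisms $g$ of $A$ with $g(x_j)-x_j\in\mathfrak m^2$ for all $j$ that preserve $\operatorname{vol}$, i.e. $\det(\partial g(x_i)/\partial x_j)=1$. For $s\ge2$, $G_s=\{g\in G: g(x_j)-x_j\in\mathfrak m^s\text{ for every }j\}$, a normal subgroup of $G=G_2$. For $N\ge3$, $T_N=G/G_N$ (a finite $p$-group). $G_s/G_N$ denotes the image $G_sG_N/G_N$ of $G_s$ in $T_N$ (trivial for $s\ge N$), and $H_a=G_{a+1}/G_N$ for $a\ge1$; so $H_1=T_N$. $\Delta_{\mathbf Z}(T_N)$ is the augmentation ideal of $\mathbf Z[T_N]$. For an ideal $J\subseteq\Delta_{\mathbf Z}(T_N)$, $\mathfrak D(J)=\{g\in T_N: g-1\in J\}$. For $a\ge1$, $\mathcal A_a(H_\bullet)$ is the additive subgroup of $\mathbf Z[T_N]$ generated by all products $(h_1-1)\cdots(h_t-1)$ with $t\ge1$, $h_i\in H_{b_i}$, $b_i\ge1$ and $\sum_i b_i\ge a$. Let $B_N=A/\mathfrak m^N$ with filtration $F^qB_N=(\mathfrak m^q+\mathfrak m^N)/\mathfrak m^N$, $q\ge0$. $T_N$ acts on $B_N$ by $k$-algebra automorphisms preserving this filtration, giving a ring homomorphism $\rho_{\mathbf Z}:\mathbf Z[T_N]\to\operatorname{End}_k(B_N)$.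 For $a\ge1$, $$\mathcal I_a=\mathcal I_a^N=\{z\in\Delta_{\mathbf Z}(T_N): \rho_{\mathbf Z}(z)(F^qB_N)\subseteq F^{q+a}B_N\text{ for all }q\ge0\}.$$ *)

theory Defs
  imports
    "HOL-Analysis.Determinants"
    "HOL-Algebra.Algebra"
    "HOL-Algebra.Algebraic_Closure_Type"
    "Berlekamp_Zassenhaus.Finite_Field"
begin

section \<open>Formal power series in finitely many variables\<close>

text \<open>
  The variables are indexed by the type \<open>'n\<close>, and a series is the family of its coefficients,
  indexed by the exponent vectors of the monomials.
\<close>

typedef ('n, 'k) mps = "UNIV :: (('n \<Rightarrow> nat) \<Rightarrow> 'k) set"
  morphisms mps_coeff Abs_mps
  by simp

setup_lifting type_definition_mps

lemma mps_eqI: "(\<And>m. mps_coeff f m = mps_coeff g m) \<Longrightarrow> f = g"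
  by transfer auto

definition exp_splits :: "('n \<Rightarrow> nat) \<Rightarrow> (('n \<Rightarrow> nat) \<times> ('n \<Rightarrow> nat)) set"
  where "exp_splits m = {(a, b). \<forall>i. a i + b i = m i}"

lemma finite_exp_splits [simp]: "finite (exp_splits (m :: 'n::finite \<Rightarrow> nat))"
proof -
  define E where "E = (PiE UNIV (\<lambda>i. {..m i}) :: ('n \<Rightarrow> nat) set)"
  have "finite E"
    unfolding E_def by (rule finite_PiE) auto
  moreover have "exp_splits m \<subseteq> E \<times> E"
    by (auto simp: exp_splits_def E_def PiE_def Pi_def extensional_def) (metis le_add1 le_add2)+
  ultimately show ?thesis
    by (meson finite_SigmaI finite_subset)
qed

lemma sum_exp_splits_assoc:
  fixes m :: "'n::finite \<Rightarrow> nat" and F :: "_ \<Rightarrow> _ \<Rightarrow> _ \<Rightarrow> 'b::comm_monoid_add"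
  shows "(\<Sum>(u, c)\<in>exp_splits m. \<Sum>(a, b)\<in>exp_splits u. F a b c) =
         (\<Sum>(a, v)\<in>exp_splits m. \<Sum>(b, c)\<in>exp_splits v. F a b c)"
proof -
  have "(\<Sum>(u, c)\<in>exp_splits m. \<Sum>(a, b)\<in>exp_splits u. F a b c) =
        (\<Sum>(p, q)\<in>Sigma (exp_splits m) (\<lambda>p. exp_splits (fst p)). F (fst q) (snd q) (snd p))"
    by (subst sum.Sigma [symmetric]) (auto simp: split_beta)
  also have "\<dots> = (\<Sum>(p, q)\<in>Sigma (exp_splits m) (\<lambda>p. exp_splits (snd p)).
                     F (fst p) (fst q) (snd q))"
    by (rule sum.reindex_bij_witness
          [where i = "\<lambda>((a, v), (b, c)). ((\<lambda>i. a i + b i, c), (a, b))"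
             and j = "\<lambda>((u, c), (a, b)). ((a, \<lambda>i. b i + c i), (b, c))"])
       (auto simp: exp_splits_def fun_eq_iff, (metis add.assoc)+)
  also have "\<dots> = (\<Sum>(a, v)\<in>exp_splits m. \<Sum>(b, c)\<in>exp_splits v. F a b c)"
    by (subst sum.Sigma [symmetric]) (auto simp: split_beta)
  finally show ?thesis .
qed

definition mps_const :: "'k::zero \<Rightarrow> ('n, 'k) mps"
  where "mps_const c = Abs_mps (\<lambda>m. if m = (\<lambda>_. 0) then c else 0)"

definition mps_X :: "'n \<Rightarrow> ('n, 'k::zero_neq_one) mps"
  where "mps_X j = Abs_mps (\<lambda>m. if m = (\<lambda>i. if i = j then 1 else 0) then 1 else 0)"

definition mps_pderiv :: "'n \<Rightarrow> ('n, 'k::semiring_1) mps \<Rightarrow> ('n, 'k) mps"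
  where "mps_pderiv j f = Abs_mps (\<lambda>m. of_nat (m j + 1) * mps_coeff f (m(j := m j + 1)))"

instantiation mps :: (finite, comm_ring_1) comm_ring_1
begin

definition "0 = mps_const 0"
definition "1 = mps_const 1"
definition "f + g = Abs_mps (\<lambda>m. mps_coeff f m + mps_coeff g m)"
definition "f - g = Abs_mps (\<lambda>m. mps_coeff f m - mps_coeff g m)"
definition "- f = Abs_mps (\<lambda>m. - mps_coeff f m)"
definition "f * g = Abs_mps (\<lambda>m. \<Sum>(a, b)\<in>exp_splits m. mps_coeff f a * mps_coeff g b)"

lemma mps_coeff_simps [simp]:
  fixes f g :: "('a, 'b) mps"
  shows "mps_coeff (0 :: ('a, 'b) mps) m = 0"
    "mps_coeff (1 :: ('a, 'b) mps) m = (if m = (\<lambda>_. 0) then 1 else 0)"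
    "mps_coeff (f + g) m = mps_coeff f m + mps_coeff g m"
    "mps_coeff (f - g) m = mps_coeff f m - mps_coeff g m"
    "mps_coeff (- f) m = - mps_coeff f m"
  by (simp_all add: zero_mps_def one_mps_def plus_mps_def minus_mps_def uminus_mps_def
      mps_const_def Abs_mps_inverse)

lemma mps_coeff_mult:
  fixes f g :: "('a, 'b) mps"
  shows "mps_coeff (f * g) m = (\<Sum>(a, b)\<in>exp_splits m. mps_coeff f a * mps_coeff g b)"
  by (simp add: times_mps_def Abs_mps_inverse)

instance
proof
  fix f g h :: "('a, 'b) mps"
  show "f * g * h = f * (g * h)"
  proof (rule mps_eqI)
    fix m
    have "mps_coeff (f * g * h) m = (\<Sum>(u, c)\<in>exp_splits m. \<Sum>(a, b)\<in>exp_splits u.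
            mps_coeff f a * mps_coeff g b * mps_coeff h c)"
      by (simp add: mps_coeff_mult sum_distrib_right split_beta)
    also have "\<dots> = (\<Sum>(a, v)\<in>exp_splits m. \<Sum>(b, c)\<in>exp_splits v.
            mps_coeff f a * mps_coeff g b * mps_coeff h c)"
      by (rule sum_exp_splits_assoc)
    also have "\<dots> = mps_coeff (f * (g * h)) m"
      by (simp add: mps_coeff_mult sum_distrib_left split_beta mult.assoc)
    finally show "mps_coeff (f * g * h) m = mps_coeff (f * (g * h)) m" .
  qed
  show "f * g = g * f"
  proof (rule mps_eqI)
    fix m
    show "mps_coeff (f * g) m = mps_coeff (g * f) m"
      unfolding mps_coeff_mult
      by (rule sum.reindex_bij_witness [where i = prod.swap and j = prod.swap])
         (auto simp: exp_splits_def add.commute mult.commute)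
  qed
  show "1 * f = f"
  proof (rule mps_eqI)
    fix m
    have "mps_coeff (1 * f) m = (\<Sum>(a, b)\<in>{(\<lambda>_. 0, m)}. mps_coeff 1 a * mps_coeff f b)"
      unfolding mps_coeff_mult
    proof (rule sum.mono_neutral_right)
      show "finite (exp_splits m)"
        by simp
    qed (auto simp: exp_splits_def fun_eq_iff split: if_splits)
    then show "mps_coeff (1 * f) m = mps_coeff f m"
      by simp
  qed
  show "(f + g) * h = f * h + g * h"
    by (rule mps_eqI) (simp add: mps_coeff_mult split_beta distrib_right sum.distrib)
  show "f + g + h = f + (g + h)" "f + g = g + f" "0 + f = f" "- f + f = 0" "f - g = f + - g"
    by (auto intro!: mps_eqI simp: add_ac)
  show "(0 :: ('a, 'b) mps) \<noteq> 1"
  proof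
    assume "(0 :: ('a, 'b) mps) = 1"
    then have "mps_coeff (0 :: ('a, 'b) mps) (\<lambda>_. 0) = mps_coeff (1 :: ('a, 'b) mps) (\<lambda>_. 0)"
      by simp
    then show False
      by simp
  qed
qed

end

text \<open>The ring \<open>A\<close>, its maximal ideal, and the powers of the latter (as products of ideals).\<close>

abbreviation mps_ring :: "('n::finite, 'k::comm_ring_1) mps ring"
  where "mps_ring \<equiv> ring_of_type_algebra"

definition mps_max :: "('n::finite, 'k::comm_ring_1) mps set"
  where "mps_max = Idl\<^bsub>mps_ring\<^esub> (range mps_X)"

primrec mps_max_pow :: "nat \<Rightarrow> ('n::finite, 'k::comm_ring_1) mps set"
  where
    "mps_max_pow 0 = carrier mps_ring"
  | "mps_max_pow (Suc s) = mps_max \<cdot>\<^bsub>mps_ring\<^esub> mps_max_pow s"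


section \<open>Volume-preserving automorphisms and the groups of jets\<close>

type_synonym ('n, 'k) mps_map = "('n, 'k) mps \<Rightarrow> ('n, 'k) mps"

definition adic_continuous :: "('n::finite, 'k::comm_ring_1) mps_map \<Rightarrow> bool"
  where "adic_continuous g \<longleftrightarrow>
    (\<forall>f s. \<exists>t. \<forall>h. h - f \<in> mps_max_pow t \<longrightarrow> g h - g f \<in> mps_max_pow s)"

definition continuous_automorphisms :: "('n::finite, 'k::comm_ring_1) mps_map set"
  where "continuous_automorphisms =
    {g \<in> ring_iso mps_ring mps_ring. (\<forall>c. g (mps_const c) = mps_const c) \<and> adic_continuous g}"

definition jacobian :: "('n::finite, 'k::comm_ring_1) mps_map \<Rightarrow> ('n, 'k) mps ^ 'n ^ 'n"
  where "jacobian g = (\<chi> i j. mps_pderiv j (g (mps_X i)))"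

definition vol_group :: "('n::finite, 'k::comm_ring_1) mps_map monoid"
  where "vol_group =
    \<lparr>carrier = {g \<in> continuous_automorphisms.
        (\<forall>j. g (mps_X j) - mps_X j \<in> mps_max_pow 2) \<and> det (jacobian g) = 1},
     monoid.mult = (\<circ>), one = id\<rparr>"

definition vol_subgroup :: "nat \<Rightarrow> ('n::finite, 'k::comm_ring_1) mps_map set"
  where "vol_subgroup s =
    {g \<in> carrier vol_group. \<forall>j. g (mps_X j) - mps_X j \<in> mps_max_pow s}"

definition jet_group :: "nat \<Rightarrow> ('n::finite, 'k::comm_ring_1) mps_map set monoid"
  where "jet_group N = vol_group Mod vol_subgroup N"

text \<open>\<open>jet_subgroup N s\<close> is \<open>G\<^sub>s/G\<^sub>N\<close>, that is, the image of \<open>G\<^sub>s\<close> in \<open>T\<^sub>N\<close>.\<close>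

definition jet_subgroup :: "nat \<Rightarrow> nat \<Rightarrow> ('n::finite, 'k::comm_ring_1) mps_map set set"
  where "jet_subgroup N s = (\<lambda>g. vol_subgroup N #>\<^bsub>vol_group\<^esub> g) ` vol_subgroup s"

definition jet_weight :: "nat \<Rightarrow> nat \<Rightarrow> ('n::finite, 'k::comm_ring_1) mps_map set set"
  where "jet_weight N a = jet_subgroup N (a + 1)"

text \<open>The quotient map \<open>T\<^sub>N\<^sub>' \<rightarrow> T\<^sub>N\<close> (for \<open>N \<le> N'\<close>) does not mention \<open>N'\<close>: it sends a coset \<open>C\<close> to
  the common \<open>G\<^sub>N\<close>-coset of all elements of \<open>C\<close>.\<close>

definition jet_quotient ::
    "nat \<Rightarrow> ('n::finite, 'k::comm_ring_1) mps_map set \<Rightarrow> ('n, 'k) mps_map set"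
  where "jet_quotient N C = the_elem ((\<lambda>g. vol_subgroup N #>\<^bsub>vol_group\<^esub> g) ` C)"


section \<open>Integral group rings\<close>

definition group_ring :: "('g, 'm) monoid_scheme \<Rightarrow> ('g \<Rightarrow>\<^sub>0 int) ring"
  where "group_ring T =
    \<lparr>carrier = {z. Poly_Mapping.keys z \<subseteq> carrier T},
     monoid.mult = (\<lambda>y z. frag_extend (\<lambda>g. frag_extend (\<lambda>h. frag_of (g \<otimes>\<^bsub>T\<^esub> h)) z) y),
     one = frag_of \<one>\<^bsub>T\<^esub>,
     ring.zero = 0,
     add = (+)\<rparr>"

definition augmentation :: "('g \<Rightarrow>\<^sub>0 int) \<Rightarrow> int"
  where "augmentation z = (\<Sum>g\<in>Poly_Mapping.keys z. Poly_Mapping.lookup z g)"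

definition aug_ideal :: "('g, 'm) monoid_scheme \<Rightarrow> ('g \<Rightarrow>\<^sub>0 int) set"
  where "aug_ideal T = {z \<in> carrier (group_ring T). augmentation z = 0}"

definition group_ring_diff :: "('g, 'm) monoid_scheme \<Rightarrow> 'g \<Rightarrow> ('g \<Rightarrow>\<^sub>0 int)"
  where "group_ring_diff T g = frag_of g \<ominus>\<^bsub>group_ring T\<^esub> \<one>\<^bsub>group_ring T\<^esub>"

definition dim_subgroup :: "('g, 'm) monoid_scheme \<Rightarrow> ('g \<Rightarrow>\<^sub>0 int) set \<Rightarrow> 'g set"
  where "dim_subgroup T J = {g \<in> carrier T. group_ring_diff T g \<in> J}"

definition group_ring_map :: "('g \<Rightarrow> 'h) \<Rightarrow> ('g \<Rightarrow>\<^sub>0 int) \<Rightarrow> ('h \<Rightarrow>\<^sub>0 int)"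
  where "group_ring_map f = frag_extend (\<lambda>g. frag_of (f g))"

text \<open>A generator \<open>(h\<^sub>1 - 1) \<dots> (h\<^sub>t - 1)\<close> is given by the nonempty list of the pairs \<open>(b\<^sub>i, h\<^sub>i)\<close>.\<close>

definition weighted_ideal ::
    "('g, 'm) monoid_scheme \<Rightarrow> (nat \<Rightarrow> 'g set) \<Rightarrow> nat \<Rightarrow> ('g \<Rightarrow>\<^sub>0 int) set"
  where "weighted_ideal T H a = generate (add_monoid (group_ring T))
    {foldr (\<otimes>\<^bsub>group_ring T\<^esub>) (map (\<lambda>(b, h). group_ring_diff T h) bhs) \<one>\<^bsub>group_ring T\<^esub> | bhs.
       bhs \<noteq> [] \<and> (\<forall>(b, h)\<in>set bhs. b \<ge> 1 \<and> h \<in> H b) \<and> sum_list (map fst bhs) \<ge> a}"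


section \<open>The action on jets of functions\<close>

definition jet_ring :: "nat \<Rightarrow> ('n::finite, 'k::comm_ring_1) mps set ring"
  where "jet_ring N = mps_ring Quot mps_max_pow N"

definition jet_filtration :: "nat \<Rightarrow> nat \<Rightarrow> ('n::finite, 'k::comm_ring_1) mps set set"
  where "jet_filtration N q = (\<lambda>f. mps_max_pow N +>\<^bsub>mps_ring\<^esub> f) `
    (mps_max_pow q <+>\<^bsub>mps_ring\<^esub> mps_max_pow N)"

text \<open>The class \<open>C\<close> of \<open>g\<close> sends the class \<open>b\<close> of \<open>f\<close> to the class of \<open>g f\<close>.\<close>

definition jet_action ::
    "nat \<Rightarrow> ('n::finite, 'k::comm_ring_1) mps_map set \<Rightarrow> ('n, 'k) mps set \<Rightarrow> ('n, 'k) mps set"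
  where "jet_action N C b = the_elem {mps_max_pow N +>\<^bsub>mps_ring\<^esub> g f | g f. g \<in> C \<and> f \<in> b}"

definition jet_rep ::
    "nat \<Rightarrow> (('n::finite, 'k::comm_ring_1) mps_map set \<Rightarrow>\<^sub>0 int) \<Rightarrow> ('n, 'k) mps set \<Rightarrow> ('n, 'k) mps set"
  where "jet_rep N z b =
    (\<Oplus>\<^bsub>jet_ring N\<^esub>C\<in>Poly_Mapping.keys z. [Poly_Mapping.lookup z C] \<cdot>\<^bsub>jet_ring N\<^esub> jet_action N C b)"

definition jet_ideal ::
    "nat \<Rightarrow> nat \<Rightarrow> (('n::finite, 'k::comm_ring_1) mps_map set \<Rightarrow>\<^sub>0 int) set"
  where "jet_ideal N a =
    {z \<in> aug_ideal (jet_group N). \<forall>q. jet_rep N z ` jet_filtration N q \<subseteq> jet_filtration N (q + a)}"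

end

theory Submission
  imports Defs
begin

text \<open>
  Over an arbitrary group, the weighted ideals form the least multiplicative filtration \<open>J\<close> of the
  group ring with \<open>h - 1 \<in> J\<^sub>b\<close> for \<open>h \<in> H\<^sub>b\<close>. An action on a filtered abelian group yields another
  multiplicative filtration, by the elements of the augmentation ideal that raise the filtration
  by \<open>a\<close>. For the action of \<open>T\<^sub>N\<close> on \<open>B\<^sub>N\<close>, the class of \<open>g - 1\<close> raises the filtration by \<open>a\<close> if and
  only if it sends the variables into \<open>F\<^bsup>a+1\<^esup>\<close>, so the dimension subgroups of the second filtration
  are exactly the \<open>H\<^sub>a\<close>. By minimality the first filtration is contained in the second, and it has
  the same dimension subgroups.
\<close>

section \<open>Multiplicative filtrations of rings\<close>

lemma (in ring) mult_generate_mem: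
  assumes "S \<subseteq> carrier R" "T \<subseteq> carrier R" and K: "additive_subgroup K R"
    and mult_mem: "\<And>s t. s \<in> S \<Longrightarrow> t \<in> T \<Longrightarrow> s \<otimes> t \<in> K"
    and x: "x \<in> generate (add_monoid R) S" and y: "y \<in> generate (add_monoid R) T"
  shows "x \<otimes> y \<in> K"
proof -
  interpret K: additive_subgroup K R
    by (rule K)
  have S: "generate (add_monoid R) S \<subseteq> carrier R" and T: "generate (add_monoid R) T \<subseteq> carrier R"
    using add.generate_in_carrier assms(1,2) by auto
  have generator_mult: "s \<otimes> y \<in> K" if "s \<in> S" for s
    using y
  proof induction
    case (inv t)
    then show ?case
      using that assms(1,2) mult_mem[of s t] by (fastforce simp: r_minus simp flip: a_inv_def)
  next
    case (eng t t')
    then show ?case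
      using that assms(1) T by (auto simp: r_distr subset_iff)
  qed (use that assms(1) mult_mem in auto)
  from x show ?thesis
  proof induction
    case (inv s)
    then show ?case
      using assms(1) T y generator_mult[of s] by (fastforce simp: l_minus simp flip: a_inv_def)
  next
    case (eng s s')
    then show ?case
      using S T y by (auto simp: l_distr subset_iff)
  qed (use T y generator_mult in auto)
qed

locale multiplicative_filtration = ring R for R (structure) +
  fixes J :: "nat \<Rightarrow> 'a set"
  assumes ideal: "ideal (J a) R"
    and Suc_subset: "J (Suc a) \<subseteq> J a"
    and mult_mem: "\<lbrakk>x \<in> J a; y \<in> J b\<rbrakk> \<Longrightarrow> x \<otimes> y \<in> J (a + b)"
begin

lemma antimono: "a \<le> b \<Longrightarrow> J b \<subseteq> J a"
  using Suc_subset by (rule lift_Suc_antimono_le)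

lemma ideal_prod_subset: "J a \<cdot> J b \<subseteq> J (a + b)"
proof
  interpret ideal "J (a + b)" R
    by (rule ideal)
  fix x
  assume "x \<in> J a \<cdot> J b"
  then show "x \<in> J (a + b)"
    by induction (auto intro: mult_mem)
qed

end


section \<open>Integral group rings\<close>

lemma carrier_group_ring_iff: "z \<in> carrier (group_ring G) \<longleftrightarrow> Poly_Mapping.keys z \<subseteq> carrier G"
  by (simp add: group_ring_def)

lemma group_ring_simps [simp]:
  "add (group_ring G) = (+)" "\<zero>\<^bsub>group_ring G\<^esub> = 0" "\<one>\<^bsub>group_ring G\<^esub> = frag_of \<one>\<^bsub>G\<^esub>"
  by (simp_all add: group_ring_def)

lemma frag_of_in_group_ring [simp]: "frag_of g \<in> carrier (group_ring G) \<longleftrightarrow> g \<in> carrier G"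
  by (simp add: carrier_group_ring_iff)

lemma add_monoid_group_ring: "add_monoid (group_ring G) = free_Abelian_group (carrier G)"
  by (simp add: group_ring_def free_Abelian_group_def)

lemma abelian_group_group_ring: "abelian_group (group_ring G)"
  by (rule comm_group_abelian_groupI)
    (unfold add_monoid_group_ring, rule abelian_free_Abelian_group)

lemma group_ring_a_inv: "x \<in> carrier (group_ring G) \<Longrightarrow> \<ominus>\<^bsub>group_ring G\<^esub> x = - x"
  unfolding a_inv_def add_monoid_group_ring by (simp add: carrier_group_ring_iff)

lemma group_ring_minus: "y \<in> carrier (group_ring G) \<Longrightarrow> x \<ominus>\<^bsub>group_ring G\<^esub> y = x - y"
  by (simp add: a_minus_def group_ring_a_inv)

lemma group_ring_induct [consumes 1, case_names zero diff single]:
  assumes "z \<in> carrier (group_ring G)" "P 0"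
    and "\<And>x y. \<lbrakk>x \<in> carrier (group_ring G); y \<in> carrier (group_ring G); P x; P y\<rbrakk> \<Longrightarrow> P (x - y)"
    and "\<And>g. g \<in> carrier G \<Longrightarrow> P (frag_of g)"
  shows "P z"
  using assms unfolding carrier_group_ring_iff by (rule free_Abelian_group_induct)

lemma additive_subgroup_group_ring_minus:
  assumes "additive_subgroup K (group_ring G)" "x \<in> K" "y \<in> K"
  shows "x - y \<in> K"
proof -
  interpret additive_subgroup K "group_ring G"
    by (rule assms(1))
  have "x \<oplus>\<^bsub>group_ring G\<^esub> \<ominus>\<^bsub>group_ring G\<^esub> y \<in> K"
    using assms(2,3) by blast
  then show ?thesis
    using assms(3) a_subset by (auto simp: group_ring_a_inv subset_iff)
qed

lemma additive_subgroup_group_ringI: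
  assumes "K \<subseteq> carrier (group_ring G)" "0 \<in> K" "\<And>x y. \<lbrakk>x \<in> K; y \<in> K\<rbrakk> \<Longrightarrow> x - y \<in> K"
  shows "additive_subgroup K (group_ring G)"
proof (rule additive_subgroupI, rule group.subgroupI)
  have minus: "- x \<in> K" if "x \<in> K" for x
    using assms(3)[OF assms(2) that] by simp
  show "inv\<^bsub>add_monoid (group_ring G)\<^esub> x \<in> K" if "x \<in> K" for x
    using that assms(1) minus by (simp only: group_ring_a_inv subset_iff flip: a_inv_def)
  show "x \<otimes>\<^bsub>add_monoid (group_ring G)\<^esub> y \<in> K" if "x \<in> K" "y \<in> K" for x y
    using assms(3)[OF that(1) minus[OF that(2)]] by simp
qed (use assms(1,2) abelian_group.a_group[OF abelian_group_group_ring] in auto)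

lemma group_ring_mult:
  "y \<otimes>\<^bsub>group_ring G\<^esub> z = frag_extend (\<lambda>g. frag_extend (\<lambda>h. frag_of (g \<otimes>\<^bsub>G\<^esub> h)) z) y"
  by (simp add: group_ring_def)

lemma group_ring_mult_of [simp]:
  "frag_of g \<otimes>\<^bsub>group_ring G\<^esub> frag_of h = frag_of (g \<otimes>\<^bsub>G\<^esub> h)"
  by (simp add: group_ring_mult)

lemma group_ring_mult_zero [simp]:
  "0 \<otimes>\<^bsub>group_ring G\<^esub> z = 0" "z \<otimes>\<^bsub>group_ring G\<^esub> 0 = 0"
  by (simp_all add: group_ring_mult frag_extend_eq_0)

lemma group_ring_distrib:
  "(x + y) \<otimes>\<^bsub>group_ring G\<^esub> z = x \<otimes>\<^bsub>group_ring G\<^esub> z + y \<otimes>\<^bsub>group_ring G\<^esub> z"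
  "z \<otimes>\<^bsub>group_ring G\<^esub> (x + y) = z \<otimes>\<^bsub>group_ring G\<^esub> x + z \<otimes>\<^bsub>group_ring G\<^esub> y"
  by (simp_all add: group_ring_mult frag_extend_add)
    (simp add: frag_extend_def frag_cmul_distrib2 sum.distrib)

lemma group_ring_minus_distrib:
  "(x - y) \<otimes>\<^bsub>group_ring G\<^esub> z = x \<otimes>\<^bsub>group_ring G\<^esub> z - y \<otimes>\<^bsub>group_ring G\<^esub> z"
  "z \<otimes>\<^bsub>group_ring G\<^esub> (x - y) = z \<otimes>\<^bsub>group_ring G\<^esub> x - z \<otimes>\<^bsub>group_ring G\<^esub> y"
  by (simp_all add: eq_diff_eq flip: group_ring_distrib)

context group
begin

lemma group_ring_mult_closed:
  assumes "y \<in> carrier (group_ring G)" "z \<in> carrier (group_ring G)"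
  shows "y \<otimes>\<^bsub>group_ring G\<^esub> z \<in> carrier (group_ring G)"
  using assms unfolding carrier_group_ring_iff group_ring_mult
  by (fastforce dest!: subsetD[OF keys_frag_extend] split: if_splits)

lemma group_ring_mult_assoc:
  assumes "x \<in> carrier (group_ring G)" "y \<in> carrier (group_ring G)" "z \<in> carrier (group_ring G)"
  shows "x \<otimes>\<^bsub>group_ring G\<^esub> y \<otimes>\<^bsub>group_ring G\<^esub> z = x \<otimes>\<^bsub>group_ring G\<^esub> (y \<otimes>\<^bsub>group_ring G\<^esub> z)"
  using assms(1)
proof (induction x rule: group_ring_induct)
  case (single g)
  show ?case
    using assms(2)
  proof (induction y rule: group_ring_induct)
    case (single h)
    show ?case
      using assms(3) \<open>g \<in> carrier G\<close> \<open>h \<in> carrier G\<close>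
      by (induction z rule: group_ring_induct) (simp_all add: group_ring_minus_distrib m_assoc)
  qed (simp_all add: group_ring_minus_distrib)
qed (simp_all add: group_ring_minus_distrib)

lemma group_ring_mult_one:
  assumes "z \<in> carrier (group_ring G)"
  shows "frag_of \<one> \<otimes>\<^bsub>group_ring G\<^esub> z = z" "z \<otimes>\<^bsub>group_ring G\<^esub> frag_of \<one> = z"
  using assms by (induction z rule: group_ring_induct) (simp_all add: group_ring_minus_distrib)

lemma group_ring_is_ring: "ring (group_ring G)"
  by (intro ringI abelian_group_group_ring monoidI)
    (simp_all add: group_ring_mult_closed group_ring_mult_assoc group_ring_mult_one
      group_ring_distrib)

end

lemma (in group) group_ring_diff_eq: "group_ring_diff G g = frag_of g - frag_of \<one>"
  by (simp add: group_ring_diff_def group_ring_minus)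

lemma (in group) group_ring_diff_closed:
  assumes "g \<in> carrier G"
  shows "group_ring_diff G g \<in> carrier (group_ring G)"
proof -
  interpret R: ring "group_ring G"
    by (rule group_ring_is_ring)
  show ?thesis
    unfolding group_ring_diff_def using assms R.one_closed by (intro R.minus_closed) simp_all
qed

lemma additive_subgroup_group_ring_generate:
  "S \<subseteq> carrier (group_ring G) \<Longrightarrow>
    additive_subgroup (generate (add_monoid (group_ring G)) S) (group_ring G)"
  by (intro additive_subgroupI group.generate_is_subgroup abelian_group.a_group
      abelian_group_group_ring) simp

lemma (in group) carrier_group_ring_eq_generate:
  "carrier (group_ring G) = generate (add_monoid (group_ring G)) (frag_of ` carrier G)"
proof
  define D where "D = generate (add_monoid (group_ring G)) (frag_of ` carrier G)"
  interpret D: additive_subgroup D "group_ring G"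
    unfolding D_def by (rule additive_subgroup_group_ring_generate) auto
  show "D \<subseteq> carrier (group_ring G)"
    by (rule D.a_subset)
  show "carrier (group_ring G) \<subseteq> D"
  proof
    fix z
    assume "z \<in> carrier (group_ring G)"
    then show "z \<in> D"
    proof (induction z rule: group_ring_induct)
      case zero
      then show ?case
        using D.zero_closed by simp
    next
      case (diff x y)
      then show ?case
        by (intro additive_subgroup_group_ring_minus[OF D.additive_subgroup_axioms])
    next
      case (single g)
      then show ?case
        unfolding D_def by (intro generate.incl imageI)
    qed
  qed
qed

lemma augmentation_eq_lookup:
  "augmentation z = Poly_Mapping.lookup (frag_extend (\<lambda>_. frag_of ()) z) ()"
  by (simp add: augmentation_def frag_extend_def lookup_sum)

lemma augmentation_simps [simp]:
  "augmentation 0 = 0" "augmentation (frag_of g) = 1"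
  "augmentation (y - z) = augmentation y - augmentation z"
  by (simp_all add: augmentation_eq_lookup frag_extend_diff lookup_minus)

lemma augmentation_group_ring_map: "augmentation (group_ring_map f z) = augmentation z"
  using frag_extend_compose[of "\<lambda>_. frag_of ()" f z]
  by (simp add: augmentation_eq_lookup group_ring_map_def comp_def)

lemma augmentation_mult: "augmentation (y \<otimes>\<^bsub>group_ring G\<^esub> z) = augmentation y * augmentation z"
  using subset_UNIV[of "Poly_Mapping.keys y"]
proof (induction y rule: frag_induction)
  case (one g)
  then show ?case
    using augmentation_group_ring_map[of "\<lambda>h. g \<otimes>\<^bsub>G\<^esub> h" z]
    by (simp add: group_ring_mult group_ring_map_def)
qed (simp_all add: group_ring_minus_distrib left_diff_distrib)

lemma (in group) group_ring_diff_in_aug_ideal: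
  "g \<in> carrier G \<Longrightarrow> group_ring_diff G g \<in> aug_ideal G"
  using group_ring_diff_closed by (simp add: aug_ideal_def group_ring_diff_eq)

lemma (in group) aug_ideal_ideal: "ideal (aug_ideal G) (group_ring G)"
proof (rule idealI)
  interpret R: ring "group_ring G"
    by (rule group_ring_is_ring)
  show "ring (group_ring G)"
    by (rule group_ring_is_ring)
  have "x - y \<in> aug_ideal G" if "x \<in> aug_ideal G" "y \<in> aug_ideal G" for x y
    using that R.minus_closed[of x y] by (simp add: aug_ideal_def group_ring_minus)
  then show "subgroup (aug_ideal G) (add_monoid (group_ring G))"
    using R.zero_closed
    by (intro additive_subgroup.a_subgroup additive_subgroup_group_ringI) (auto simp: aug_ideal_def)
  show "x \<otimes>\<^bsub>group_ring G\<^esub> z \<in> aug_ideal G" "z \<otimes>\<^bsub>group_ring G\<^esub> x \<in> aug_ideal G"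
    if "z \<in> aug_ideal G" "x \<in> carrier (group_ring G)" for x z
    using that by (simp_all add: aug_ideal_def augmentation_mult)
qed

lemma (in group) group_ring_minus_augmentation_mem:
  assumes D: "additive_subgroup D (group_ring G)"
    and diff_mem: "\<And>g. g \<in> carrier G \<Longrightarrow> group_ring_diff G g \<in> D"
    and "z \<in> carrier (group_ring G)"
  shows "z - frag_cmul (augmentation z) (frag_of \<one>) \<in> D"
  using assms(3)
proof (induction z rule: group_ring_induct)
  case zero
  then show ?case
    using additive_subgroup.zero_closed[OF D] by simp
next
  case (diff x y)
  have "x - y - frag_cmul (augmentation (x - y)) (frag_of \<one>) =
      (x - frag_cmul (augmentation x) (frag_of \<one>)) - (y - frag_cmul (augmentation y) (frag_of \<one>))"
    by (simp add: frag_cmul_diff_distrib)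
  also have "\<dots> \<in> D"
    using diff(3,4) by (rule additive_subgroup_group_ring_minus[OF D])
  finally show ?case .
next
  case (single g)
  then show ?case
    using diff_mem[of g] by (simp add: group_ring_diff_eq)
qed

lemma (in group) aug_ideal_eq_generate:
  "aug_ideal G = generate (add_monoid (group_ring G)) (group_ring_diff G ` carrier G)"
proof
  define D where "D = generate (add_monoid (group_ring G)) (group_ring_diff G ` carrier G)"
  have D: "additive_subgroup D (group_ring G)"
    unfolding D_def using group_ring_diff_closed
    by (intro additive_subgroup_group_ring_generate) auto
  interpret aug: ideal "aug_ideal G" "group_ring G"
    by (rule aug_ideal_ideal)
  show "D \<subseteq> aug_ideal G"
    unfolding D_def using group_ring_diff_in_aug_ideal
    by (intro group.generate_subgroup_incl aug.a_group aug.a_subgroup) auto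
  show "aug_ideal G \<subseteq> D"
  proof
    fix z
    assume "z \<in> aug_ideal G"
    then have "z \<in> carrier (group_ring G)" and augmentation: "augmentation z = 0"
      unfolding aug_ideal_def by blast+
    from this(1) have "z - frag_cmul (augmentation z) (frag_of \<one>) \<in> D"
      by (rule group_ring_minus_augmentation_mem[OF D, rotated])
        (unfold D_def, intro generate.incl imageI)
    then show "z \<in> D"
      by (simp add: augmentation)
  qed
qed


section \<open>Weighted filtrations of the augmentation ideal\<close>

definition weighted_product :: "('g, 'm) monoid_scheme \<Rightarrow> (nat \<times> 'g) list \<Rightarrow> ('g \<Rightarrow>\<^sub>0 int)"
  where "weighted_product T bhs =
    foldr (\<otimes>\<^bsub>group_ring T\<^esub>) (map (\<lambda>(b, h). group_ring_diff T h) bhs) \<one>\<^bsub>group_ring T\<^esub>"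

definition weighted_lists :: "(nat \<Rightarrow> 'g set) \<Rightarrow> nat \<Rightarrow> (nat \<times> 'g) list set"
  where "weighted_lists H a =
    {bhs. bhs \<noteq> [] \<and> (\<forall>(b, h)\<in>set bhs. b \<ge> 1 \<and> h \<in> H b) \<and> sum_list (map fst bhs) \<ge> a}"

lemma weighted_ideal_eq_generate:
  "weighted_ideal T H a =
    generate (add_monoid (group_ring T)) (weighted_product T ` weighted_lists H a)"
proof -
  have "{weighted_product T bhs | bhs. bhs \<in> weighted_lists H a} =
      weighted_product T ` weighted_lists H a"
    by blast
  then show ?thesis
    by (simp add: weighted_ideal_def weighted_product_def weighted_lists_def)
qed

lemma weighted_product_Nil: "weighted_product T [] = \<one>\<^bsub>group_ring T\<^esub>"
  and weighted_product_Cons: "weighted_product T (bh # bhs) =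
    group_ring_diff T (snd bh) \<otimes>\<^bsub>group_ring T\<^esub> weighted_product T bhs"
  by (simp_all add: weighted_product_def split_beta)

context group
begin

interpretation R: ring "group_ring G"
  by (rule group_ring_is_ring)

lemma weighted_product_closed:
  "snd ` set bhs \<subseteq> carrier G \<Longrightarrow> weighted_product G bhs \<in> carrier (group_ring G)"
  by (induction bhs)
    (simp_all only: weighted_product_Nil weighted_product_Cons R.one_closed R.m_closed
      group_ring_diff_closed list.set image_insert insert_subset)

lemma weighted_product_append:
  assumes "snd ` set bhs \<subseteq> carrier G" "snd ` set bhs' \<subseteq> carrier G"
  shows "weighted_product G (bhs @ bhs') =
    weighted_product G bhs \<otimes>\<^bsub>group_ring G\<^esub> weighted_product G bhs'"
  using assms(1)
proof (induction bhs)
  case Nil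
  then show ?case
    using R.l_one[OF weighted_product_closed[OF assms(2)]] by (simp add: weighted_product_Nil)
next
  case (Cons bh bhs)
  then show ?case
    using assms(2)
    by (simp add: weighted_product_Cons R.m_assoc weighted_product_closed group_ring_diff_closed)
qed

end

locale weighted_group = group G for G (structure) +
  fixes H :: "nat \<Rightarrow> 'a set"
  assumes weight_subset: "H b \<subseteq> carrier G"
begin

interpretation R: ring "group_ring G"
  by (rule group_ring_is_ring)

lemma weighted_lists_carrier: "bhs \<in> weighted_lists H a \<Longrightarrow> snd ` set bhs \<subseteq> carrier G"
  using weight_subset by (fastforce simp: weighted_lists_def)

lemma weighted_products_subset_carrier:
  "weighted_product G ` weighted_lists H a \<subseteq> carrier (group_ring G)"
  using weighted_product_closed weighted_lists_carrier by blast

lemma weighted_ideal_additive_subgroup: "additive_subgroup (weighted_ideal G H a) (group_ring G)"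
  unfolding weighted_ideal_eq_generate
  by (intro additive_subgroup_group_ring_generate weighted_products_subset_carrier)

lemma weighted_product_in_weighted_ideal:
  "bhs \<in> weighted_lists H a \<Longrightarrow> weighted_product G bhs \<in> weighted_ideal G H a"
  unfolding weighted_ideal_eq_generate by (intro generate.incl imageI)

lemma weighted_ideal_mult:
  assumes "x \<in> weighted_ideal G H a" "y \<in> weighted_ideal G H b"
  shows "x \<otimes>\<^bsub>group_ring G\<^esub> y \<in> weighted_ideal G H (a + b)"
proof (rule R.mult_generate_mem)
  fix s t
  assume "s \<in> weighted_product G ` weighted_lists H a" "t \<in> weighted_product G ` weighted_lists H b"
  then obtain bhs bhs' where lists: "bhs \<in> weighted_lists H a" "bhs' \<in> weighted_lists H b"
    and st: "s = weighted_product G bhs" "t = weighted_product G bhs'"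
    by blast
  have "bhs @ bhs' \<in> weighted_lists H (a + b)"
    using lists by (auto simp: weighted_lists_def)
  then show "s \<otimes>\<^bsub>group_ring G\<^esub> t \<in> weighted_ideal G H (a + b)"
    using weighted_product_in_weighted_ideal lists[THEN weighted_lists_carrier]
    by (simp add: st flip: weighted_product_append)
qed (use assms weighted_products_subset_carrier weighted_ideal_additive_subgroup
    in \<open>simp_all add: weighted_ideal_eq_generate\<close>)

lemma weighted_ideal_antimono:
  assumes "a \<le> b"
  shows "weighted_ideal G H b \<subseteq> weighted_ideal G H a"
proof -
  have "weighted_lists H b \<subseteq> weighted_lists H a"
    using assms by (auto simp: weighted_lists_def)
  then show ?thesis
    unfolding weighted_ideal_eq_generate by (intro R.add.mono_generate image_mono)
qed

lemma weight_subset_dim_subgroup: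
  assumes "1 \<le> a"
  shows "H a \<subseteq> dim_subgroup G (weighted_ideal G H a)"
proof
  fix h
  assume h: "h \<in> H a"
  then have "h \<in> carrier G"
    using weight_subset by blast
  moreover have "weighted_product G [(a, h)] \<in> weighted_ideal G H a"
    using assms h by (intro weighted_product_in_weighted_ideal) (simp add: weighted_lists_def)
  ultimately show "h \<in> dim_subgroup G (weighted_ideal G H a)"
    by (simp add: dim_subgroup_def weighted_product_Nil weighted_product_Cons R.r_one
        group_ring_diff_closed del: group_ring_simps)
qed

lemma weighted_ideal_1:
  assumes "H 1 = carrier G"
  shows "weighted_ideal G H 1 = aug_ideal G"
proof
  interpret aug: ideal "aug_ideal G" "group_ring G"
    by (rule aug_ideal_ideal)
  have "weighted_product G bhs \<in> aug_ideal G" if "bhs \<in> weighted_lists H 1" for bhs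
  proof -
    have "bhs \<noteq> []"
      using that by (simp add: weighted_lists_def)
    then obtain bh bhs' where bhs: "bhs = bh # bhs'"
      by (cases bhs) auto
    then show ?thesis
      using weighted_lists_carrier[OF that]
      by (simp add: weighted_product_Cons aug.I_r_closed group_ring_diff_in_aug_ideal
          weighted_product_closed)
  qed
  then show "weighted_ideal G H 1 \<subseteq> aug_ideal G"
    unfolding weighted_ideal_eq_generate by (intro R.add.generate_subgroup_incl aug.a_subgroup) auto
  show "aug_ideal G \<subseteq> weighted_ideal G H 1"
    unfolding aug_ideal_eq_generate
    using weight_subset_dim_subgroup[of 1] assms
    by (intro R.add.generate_subgroup_incl additive_subgroup.a_subgroup
        weighted_ideal_additive_subgroup)
      (auto simp: dim_subgroup_def)
qed

text \<open>If \<open>H\<^sub>1 = G\<close>, writing \<open>g = (g - 1) + 1\<close> reduces multiplication by group elements to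
  multiplication by elements of the first ideal.\<close>

lemma weighted_ideal_mult_frag_of:
  assumes "H 1 = carrier G" and g: "g \<in> carrier G" and x: "x \<in> weighted_ideal G H a"
  shows "frag_of g \<otimes>\<^bsub>group_ring G\<^esub> x \<in> weighted_ideal G H a"
    and "x \<otimes>\<^bsub>group_ring G\<^esub> frag_of g \<in> weighted_ideal G H a"
proof -
  interpret W: additive_subgroup "weighted_ideal G H a" "group_ring G"
    by (rule weighted_ideal_additive_subgroup)
  have x_closed: "x \<in> carrier (group_ring G)"
    using x W.a_subset by blast
  have diff: "group_ring_diff G g \<in> weighted_ideal G H 1"
    using g by (simp only: weighted_ideal_1[OF assms(1)] group_ring_diff_in_aug_ideal)
  have diff_mult: "group_ring_diff G g \<otimes>\<^bsub>group_ring G\<^esub> x \<in> weighted_ideal G H a"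
    using weighted_ideal_mult[OF diff x] weighted_ideal_antimono[of a "1 + a"] by auto
  have mult_diff: "x \<otimes>\<^bsub>group_ring G\<^esub> group_ring_diff G g \<in> weighted_ideal G H a"
    using weighted_ideal_mult[OF x diff] weighted_ideal_antimono[of a "a + 1"] by auto
  have frag_of_eq: "frag_of g = group_ring_diff G g \<oplus>\<^bsub>group_ring G\<^esub> \<one>\<^bsub>group_ring G\<^esub>"
    by (simp add: group_ring_diff_eq)
  show "frag_of g \<otimes>\<^bsub>group_ring G\<^esub> x \<in> weighted_ideal G H a"
    unfolding frag_of_eq using g x x_closed diff_mult
    by (simp only: R.l_distr R.l_one R.one_closed group_ring_diff_closed W.a_closed)
  show "x \<otimes>\<^bsub>group_ring G\<^esub> frag_of g \<in> weighted_ideal G H a"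
    unfolding frag_of_eq using g x x_closed mult_diff
    by (simp only: R.r_distr R.r_one R.one_closed group_ring_diff_closed W.a_closed)
qed

lemma weighted_ideal_ideal:
  assumes "H 1 = carrier G"
  shows "ideal (weighted_ideal G H a) (group_ring G)"
proof (rule idealI)
  show "subgroup (weighted_ideal G H a) (add_monoid (group_ring G))"
    by (rule additive_subgroup.a_subgroup[OF weighted_ideal_additive_subgroup])
  fix x z
  assume "x \<in> weighted_ideal G H a" and "z \<in> carrier (group_ring G)"
  then have x: "x \<in> generate (add_monoid (group_ring G)) (weighted_product G ` weighted_lists H a)"
    and z: "z \<in> generate (add_monoid (group_ring G)) (frag_of ` carrier G)"
    using carrier_group_ring_eq_generate unfolding weighted_ideal_eq_generate by blast+
  have single: "frag_of g \<otimes>\<^bsub>group_ring G\<^esub> w \<in> weighted_ideal G H a"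
    "w \<otimes>\<^bsub>group_ring G\<^esub> frag_of g \<in> weighted_ideal G H a"
    if "g \<in> carrier G" "w \<in> weighted_product G ` weighted_lists H a" for g w
    using that weighted_product_in_weighted_ideal
    by (auto intro: weighted_ideal_mult_frag_of[OF assms])
  show "z \<otimes>\<^bsub>group_ring G\<^esub> x \<in> weighted_ideal G H a"
    by (rule R.mult_generate_mem[OF _ weighted_products_subset_carrier
          weighted_ideal_additive_subgroup _ z x])
      (use single(1) in auto)
  show "x \<otimes>\<^bsub>group_ring G\<^esub> z \<in> weighted_ideal G H a"
    by (rule R.mult_generate_mem[OF weighted_products_subset_carrier _
          weighted_ideal_additive_subgroup _ x z])
      (use single(2) in auto)
qed (rule group_ring_is_ring)

lemma weighted_ideal_filtration:
  assumes "H 1 = carrier G"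
  shows "multiplicative_filtration (group_ring G) (weighted_ideal G H)"
proof (intro multiplicative_filtration.intro multiplicative_filtration_axioms.intro)
  show "weighted_ideal G H (Suc a) \<subseteq> weighted_ideal G H a" for a
    by (rule weighted_ideal_antimono) simp
qed (simp_all add: group_ring_is_ring weighted_ideal_ideal[OF assms] weighted_ideal_mult)

lemma weighted_ideal_least:
  assumes "multiplicative_filtration (group_ring G) J"
    and dim: "\<And>b. 1 \<le> b \<Longrightarrow> H b \<subseteq> dim_subgroup G (J b)"
  shows "weighted_ideal G H a \<subseteq> J a"
proof -
  interpret J: multiplicative_filtration "group_ring G" J
    by (rule assms(1))
  have product: "weighted_product G bhs \<in> J (sum_list (map fst bhs))"
    if "bhs \<noteq> []" "\<forall>(b, h)\<in>set bhs. b \<ge> 1 \<and> h \<in> H b" for bhs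
    using that
  proof (induction bhs rule: list_nonempty_induct)
    case (single bh)
    then have "group_ring_diff G (snd bh) \<in> J (fst bh)" "snd bh \<in> carrier G"
      using dim weight_subset by (auto simp: dim_subgroup_def split_beta)
    then show ?case
      by (simp add: weighted_product_Nil weighted_product_Cons R.r_one group_ring_diff_closed
          del: group_ring_simps)
  next
    case (cons bh bhs)
    then have "group_ring_diff G (snd bh) \<in> J (fst bh)"
      using dim by (auto simp: dim_subgroup_def split_beta)
    then show ?case
      using cons by (simp add: weighted_product_Cons J.mult_mem)
  qed
  have "weighted_product G ` weighted_lists H a \<subseteq> J a"
    using product J.antimono by (fastforce simp: weighted_lists_def)
  then show ?thesis
    unfolding weighted_ideal_eq_generate
    by (intro R.add.generate_subgroup_incl additive_subgroup.a_subgroup ideal.axioms(1) J.ideal)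
qed

corollary dim_subgroup_weighted_ideal_eq:
  assumes "multiplicative_filtration (group_ring G) J"
    and dim: "\<And>b. 1 \<le> b \<Longrightarrow> dim_subgroup G (J b) = H b" and "1 \<le> a"
  shows "dim_subgroup G (weighted_ideal G H a) = H a"
proof
  have "weighted_ideal G H a \<subseteq> J a"
    using assms(1) by (rule weighted_ideal_least) (simp add: dim)
  then show "dim_subgroup G (weighted_ideal G H a) \<subseteq> H a"
    using dim[OF assms(3)] by (auto simp: dim_subgroup_def)
qed (rule weight_subset_dim_subgroup[OF assms(3)])

end


section \<open>Representations of group rings on filtered groups\<close>

definition group_ring_action ::
    "('b, 'r) ring_scheme \<Rightarrow> ('g \<Rightarrow> 'b \<Rightarrow> 'b) \<Rightarrow> ('g \<Rightarrow>\<^sub>0 int) \<Rightarrow> 'b \<Rightarrow> 'b"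
  where "group_ring_action M act z b =
    (\<Oplus>\<^bsub>M\<^esub>g\<in>Poly_Mapping.keys z. [Poly_Mapping.lookup z g] \<cdot>\<^bsub>M\<^esub> act g b)"

locale group_representation = group G + M: abelian_group M for G (structure) and M +
  fixes act :: "'a \<Rightarrow> 'c \<Rightarrow> 'c"
  assumes act_closed: "\<lbrakk>g \<in> carrier G; b \<in> carrier M\<rbrakk> \<Longrightarrow> act g b \<in> carrier M"
    and act_add: "\<lbrakk>g \<in> carrier G; b \<in> carrier M; c \<in> carrier M\<rbrakk> \<Longrightarrow>
      act g (b \<oplus>\<^bsub>M\<^esub> c) = act g b \<oplus>\<^bsub>M\<^esub> act g c"
    and act_one: "b \<in> carrier M \<Longrightarrow> act \<one> b = b"
    and act_mult: "\<lbrakk>g \<in> carrier G; h \<in> carrier G; b \<in> carrier M\<rbrakk> \<Longrightarrow> act (g \<otimes> h) b = act g (act h b)"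
begin

abbreviation rep :: "('a \<Rightarrow>\<^sub>0 int) \<Rightarrow> 'c \<Rightarrow> 'c"
  where "rep \<equiv> group_ring_action M act"

interpretation R: ring "group_ring G"
  by (rule group_ring_is_ring)

lemma act_hom: "g \<in> carrier G \<Longrightarrow> abelian_group_hom M M (act g)"
  by (intro abelian_group_homI M.abelian_group_axioms group_hom.intro group_hom_axioms.intro homI
      M.a_group) (simp_all add: act_closed act_add)

lemma rep_eq_finsum:
  assumes "finite K" "Poly_Mapping.keys z \<subseteq> K" "K \<subseteq> carrier G" "b \<in> carrier M"
  shows "rep z b = (\<Oplus>\<^bsub>M\<^esub>g\<in>K. [Poly_Mapping.lookup z g] \<cdot>\<^bsub>M\<^esub> act g b)"
  unfolding group_ring_action_def
proof (rule M.add.finprod_mono_neutral_cong_left)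
  show "[Poly_Mapping.lookup z g] \<cdot>\<^bsub>M\<^esub> act g b = \<zero>\<^bsub>M\<^esub>" if "g \<in> K - Poly_Mapping.keys z" for g
    using that by (simp add: in_keys_iff add_pow_def)
qed (use assms act_closed in auto)

lemma rep_zero [simp]: "rep 0 b = \<zero>\<^bsub>M\<^esub>"
  by (simp add: group_ring_action_def)

lemma rep_frag_of:
  assumes "g \<in> carrier G" "b \<in> carrier M"
  shows "rep (frag_of g) b = act g b"
  using act_closed[OF assms] M.add.int_pow_1 by (simp add: group_ring_action_def keys_frag_of)

lemma rep_closed:
  assumes "z \<in> carrier (group_ring G)" "b \<in> carrier M"
  shows "rep z b \<in> carrier M"
  unfolding group_ring_action_def using assms act_closed
  by (intro M.finsum_closed) (auto simp: carrier_group_ring_iff)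

lemma rep_add:
  assumes "y \<in> carrier (group_ring G)" "z \<in> carrier (group_ring G)" "b \<in> carrier M"
  shows "rep (y + z) b = rep y b \<oplus>\<^bsub>M\<^esub> rep z b"
proof -
  let ?K = "Poly_Mapping.keys y \<union> Poly_Mapping.keys z"
  have K: "?K \<subseteq> carrier G"
    using assms(1,2) by (simp add: carrier_group_ring_iff)
  have act: "act g b \<in> carrier M" if "g \<in> ?K" for g
    using that K act_closed assms(3) by blast
  have "rep (y + z) b = (\<Oplus>\<^bsub>M\<^esub>g\<in>?K. [Poly_Mapping.lookup (y + z) g] \<cdot>\<^bsub>M\<^esub> act g b)"
    using K assms(3) Poly_Mapping.keys_add[of y z] by (intro rep_eq_finsum) auto
  also have "\<dots> = (\<Oplus>\<^bsub>M\<^esub>g\<in>?K.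
      [Poly_Mapping.lookup y g] \<cdot>\<^bsub>M\<^esub> act g b \<oplus>\<^bsub>M\<^esub> [Poly_Mapping.lookup z g] \<cdot>\<^bsub>M\<^esub> act g b)"
    using act by (intro M.finsum_cong') (auto simp: lookup_add M.add.int_pow_mult)
  also have "\<dots> = rep y b \<oplus>\<^bsub>M\<^esub> rep z b"
    using act K assms(3) by (subst M.finsum_addf) (auto simp: rep_eq_finsum[OF _ _ K])
  finally show ?thesis .
qed

lemma rep_diff:
  assumes y: "y \<in> carrier (group_ring G)" and z: "z \<in> carrier (group_ring G)" and b: "b \<in> carrier M"
  shows "rep (y - z) b = rep y b \<ominus>\<^bsub>M\<^esub> rep z b"
proof -
  have yz: "y - z \<in> carrier (group_ring G)"
    using R.minus_closed[OF y z] by (simp add: group_ring_minus z)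
  show ?thesis
    using rep_add[OF yz z b] rep_closed[OF yz b] rep_closed[OF z b]
    by (simp add: a_minus_def M.a_assoc M.r_neg)
qed

lemma rep_mult:
  assumes y: "y \<in> carrier (group_ring G)" and z: "z \<in> carrier (group_ring G)" and b: "b \<in> carrier M"
  shows "rep (y \<otimes>\<^bsub>group_ring G\<^esub> z) b = rep y (rep z b)"
  using y
proof (induction y rule: group_ring_induct)
  case (diff x y)
  then show ?case
    using z b R.m_closed by (simp add: group_ring_minus_distrib rep_diff rep_closed)
next
  case (single g)
  interpret g: abelian_group_hom M M "act g"
    using single by (rule act_hom)
  show ?case
    using z
  proof (induction z rule: group_ring_induct)
    case (diff x y)
    then show ?case
      using single b R.m_closed[of "frag_of g"]
      by (simp add: group_ring_minus_distrib rep_diff rep_closed rep_frag_of a_minus_def)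
  next
    case (single h)
    then show ?case
      using \<open>g \<in> carrier G\<close> b by (simp add: rep_frag_of act_mult act_closed)
  qed (use single b in \<open>simp add: rep_frag_of\<close>)
qed simp

lemma rep_group_ring_diff:
  assumes "g \<in> carrier G" "b \<in> carrier M"
  shows "rep (group_ring_diff G g) b = act g b \<ominus>\<^bsub>M\<^esub> b"
  using assms by (simp add: group_ring_diff_eq rep_diff rep_frag_of act_one)

end

lemma group_ring_map_frag_of [simp]: "group_ring_map f (frag_of g) = frag_of (f g)"
  and group_ring_map_zero [simp]: "group_ring_map f 0 = 0"
  and group_ring_map_diff: "group_ring_map f (x - y) = group_ring_map f x - group_ring_map f y"
  by (simp_all add: group_ring_map_def frag_extend_diff)

lemma group_ring_map_closed:
  assumes "f ` carrier G \<subseteq> carrier G'" "z \<in> carrier (group_ring G)"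
  shows "group_ring_map f z \<in> carrier (group_ring G')"
  using assms unfolding carrier_group_ring_iff group_ring_map_def
  by (fastforce dest!: subsetD[OF keys_frag_extend] split: if_splits)

lemma group_ring_action_equivariant:
  assumes "group_representation G M act" "group_representation G' M' act'"
    and "abelian_group_hom M M' p" and f: "f ` carrier G \<subseteq> carrier G'"
    and equivariant: "\<And>g b. \<lbrakk>g \<in> carrier G; b \<in> carrier M\<rbrakk> \<Longrightarrow> p (act g b) = act' (f g) (p b)"
    and z: "z \<in> carrier (group_ring G)" and b: "b \<in> carrier M"
  shows "group_ring_action M' act' (group_ring_map f z) (p b) = p (group_ring_action M act z b)"
proof -
  interpret G: group_representation G M act by fact
  interpret G': group_representation G' M' act' by fact
  interpret p: abelian_group_hom M M' p by fact
  show ?thesis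
    using z
  proof (induction z rule: group_ring_induct)
    case (diff x y)
    then show ?case
      using b by (simp add: group_ring_map_diff G.rep_diff G'.rep_diff G.rep_closed
          group_ring_map_closed[OF f] a_minus_def)
  next
    case (single g)
    moreover from single f have "f g \<in> carrier G'"
      by blast
    ultimately show ?case
      using b by (simp add: G.rep_frag_of G'.rep_frag_of equivariant)
  qed simp
qed

locale filtered_representation = group_representation G M act
  for G (structure) and M and act :: "'a \<Rightarrow> 'c \<Rightarrow> 'c" +
  fixes F :: "nat \<Rightarrow> 'c set"
  assumes filtration_subgroup: "additive_subgroup (F q) M"
    and filtration_Suc_subset: "F (Suc q) \<subseteq> F q"
    and act_filtration: "\<lbrakk>g \<in> carrier G; b \<in> F q\<rbrakk> \<Longrightarrow> act g b \<in> F q"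
begin

interpretation R: ring "group_ring G"
  by (rule group_ring_is_ring)

interpretation aug: ideal "aug_ideal G" "group_ring G"
  by (rule aug_ideal_ideal)

definition shift_ideal :: "nat \<Rightarrow> ('a \<Rightarrow>\<^sub>0 int) set"
  where "shift_ideal a = {z \<in> aug_ideal G. \<forall>q. rep z ` F q \<subseteq> F (q + a)}"

lemma mem_shift_ideal_iff:
  "z \<in> shift_ideal a \<longleftrightarrow> z \<in> aug_ideal G \<and> (\<forall>q. \<forall>b\<in>F q. rep z b \<in> F (q + a))"
  unfolding shift_ideal_def by blast

lemma filtration_carrier: "b \<in> F q \<Longrightarrow> b \<in> carrier M"
  using additive_subgroup.a_subset[OF filtration_subgroup] by blast

lemma filtration_zero: "\<zero>\<^bsub>M\<^esub> \<in> F q"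
  by (rule additive_subgroup.zero_closed[OF filtration_subgroup])

lemma filtration_diff: "\<lbrakk>b \<in> F q; c \<in> F q\<rbrakk> \<Longrightarrow> b \<ominus>\<^bsub>M\<^esub> c \<in> F q"
  unfolding a_minus_def
  by (intro additive_subgroup.a_closed additive_subgroup.a_inv_closed filtration_subgroup)

lemma rep_filtration:
  assumes "z \<in> carrier (group_ring G)" "b \<in> F q"
  shows "rep z b \<in> F q"
  using assms(1)
proof (induction z rule: group_ring_induct)
  case (diff x y)
  then show ?case
    using assms(2) by (simp add: rep_diff filtration_diff filtration_carrier)
next
  case (single g)
  then show ?case
    using assms(2) by (simp add: rep_frag_of act_filtration filtration_carrier)
qed (simp add: filtration_zero)

lemma shift_ideal_ideal: "ideal (shift_ideal a) (group_ring G)"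
proof (rule idealI)
  have "x - y \<in> shift_ideal a" if "x \<in> shift_ideal a" "y \<in> shift_ideal a" for x y
    using that additive_subgroup_group_ring_minus[OF aug.is_additive_subgroup]
    by (simp add: mem_shift_ideal_iff rep_diff aug.Icarr filtration_carrier filtration_diff)
  then show "subgroup (shift_ideal a) (add_monoid (group_ring G))"
    using aug.zero_closed aug.Icarr filtration_zero
    by (intro additive_subgroup.a_subgroup additive_subgroup_group_ringI)
      (auto simp: mem_shift_ideal_iff)
  fix x z
  assume "x \<in> shift_ideal a" "z \<in> carrier (group_ring G)"
  then show "z \<otimes>\<^bsub>group_ring G\<^esub> x \<in> shift_ideal a" "x \<otimes>\<^bsub>group_ring G\<^esub> z \<in> shift_ideal a"
    by (simp_all add: mem_shift_ideal_iff aug.I_l_closed aug.I_r_closed rep_mult aug.Icarr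
        filtration_carrier rep_filtration)
qed (rule group_ring_is_ring)

lemma shift_ideal_filtration: "multiplicative_filtration (group_ring G) shift_ideal"
proof (intro multiplicative_filtration.intro multiplicative_filtration_axioms.intro)
  show "shift_ideal (Suc a) \<subseteq> shift_ideal a" for a
    using filtration_Suc_subset by (fastforce simp: mem_shift_ideal_iff)
  show "x \<otimes>\<^bsub>group_ring G\<^esub> y \<in> shift_ideal (a + b)"
    if "x \<in> shift_ideal a" "y \<in> shift_ideal b" for x y a b
    using that
    by (auto simp: mem_shift_ideal_iff aug.I_l_closed rep_mult aug.Icarr filtration_carrier
        add.assoc[symmetric] add.commute[of a b])
qed (simp_all add: group_ring_is_ring shift_ideal_ideal)

lemma mem_dim_subgroup_shift_ideal_iff:
  "g \<in> dim_subgroup G (shift_ideal a) \<longleftrightarrow>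
    g \<in> carrier G \<and> (\<forall>q. \<forall>b\<in>F q. act g b \<ominus>\<^bsub>M\<^esub> b \<in> F (q + a))"
  using group_ring_diff_in_aug_ideal
  by (auto simp: dim_subgroup_def mem_shift_ideal_iff rep_group_ring_diff filtration_carrier)

end

lemma group_ring_map_shift_ideal:
  assumes "filtered_representation G M act F" "filtered_representation G' M' act' F'"
    and p: "abelian_group_hom M M' p" and f: "f ` carrier G \<subseteq> carrier G'"
    and equivariant: "\<And>g b. \<lbrakk>g \<in> carrier G; b \<in> carrier M\<rbrakk> \<Longrightarrow> p (act g b) = act' (f g) (p b)"
    and filtration: "\<And>q. p ` F q = F' q"
  shows "group_ring_map f ` filtered_representation.shift_ideal G M act F a
    \<subseteq> filtered_representation.shift_ideal G' M' act' F' a"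
proof
  interpret G: filtered_representation G M act F by fact
  interpret G': filtered_representation G' M' act' F' by fact
  fix w
  assume "w \<in> group_ring_map f ` G.shift_ideal a"
  then obtain z where z: "z \<in> aug_ideal G" "\<And>q b. b \<in> F q \<Longrightarrow> G.rep z b \<in> F (q + a)"
    and w: "w = group_ring_map f z"
    by (auto simp: G.mem_shift_ideal_iff)
  have closed: "z \<in> carrier (group_ring G)"
    using z(1) by (simp add: aug_ideal_def)
  have "w \<in> aug_ideal G'"
    using z(1) group_ring_map_closed[OF f closed]
    by (simp add: w aug_ideal_def augmentation_group_ring_map)
  moreover have "G'.rep w b' \<in> F' (q + a)" if b': "b' \<in> F' q" for b' q
  proof -
    obtain b where b: "b \<in> F q" "b' = p b"
      using b' filtration[of q] by blast
    have "G'.rep w b' = p (G.rep z b)"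
      unfolding w b(2) using closed b(1) f p equivariant G.filtration_carrier
      by (intro group_ring_action_equivariant[OF G.group_representation_axioms
            G'.group_representation_axioms])
    then show ?thesis
      using z(2)[OF b(1)] filtration[of "q + a"] by blast
  qed
  ultimately show "w \<in> G'.shift_ideal a"
    by (simp add: G'.mem_shift_ideal_iff)
qed


section \<open>The adic filtration on power series\<close>

lemma type_ring_simps [simp]:
  "carrier (ring_of_type_algebra :: 'a::comm_ring_1 ring) = UNIV"
  "monoid.mult (ring_of_type_algebra :: 'a ring) = (*)"
  "one (ring_of_type_algebra :: 'a ring) = 1"
  "ring.zero (ring_of_type_algebra :: 'a ring) = 0"
  "add (ring_of_type_algebra :: 'a ring) = (+)"
  by (simp_all add: ring_of_type_algebra_def)

lemma type_ring_a_inv [simp]: "\<ominus>\<^bsub>ring_of_type_algebra\<^esub> x = - x" for x :: "'a::comm_ring_1"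
  by (rule abelian_group.minus_equality[OF ring.is_abelian_group[OF ring_from_type_algebra]]) auto

lemma type_ring_minus [simp]: "x \<ominus>\<^bsub>ring_of_type_algebra\<^esub> y = x - y" for x y :: "'a::comm_ring_1"
  by (simp add: a_minus_def)

lemma mps_coeff_sum: "mps_coeff (\<Sum>i\<in>I. F i) m = (\<Sum>i\<in>I. mps_coeff (F i) m)"
  for F :: "'i \<Rightarrow> ('n::finite, 'k::comm_ring_1) mps"
  by (induction I rule: infinite_finite_induct) auto

lemma mps_coeff_const: "mps_coeff (mps_const c) m = (if m = (\<lambda>_. 0) then c else 0)"
  by (simp add: mps_const_def Abs_mps_inverse)

lemma mps_coeff_X: "mps_coeff (mps_X j) m = (if m = (\<lambda>i. if i = j then 1 else 0) then 1 else 0)"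
  by (simp add: mps_X_def Abs_mps_inverse)

lemma mps_coeff_pderiv:
  "mps_coeff (mps_pderiv j f) m = of_nat (m j + 1) * mps_coeff f (m(j := m j + 1))"
  by (simp add: mps_pderiv_def Abs_mps_inverse)

lemma mps_coeff_X_mult:
  fixes f :: "('n::finite, 'k::comm_ring_1) mps"
  shows "mps_coeff (mps_X j * f) m = (if m j = 0 then 0 else mps_coeff f (m(j := m j - 1)))"
proof -
  let ?e = "\<lambda>i. if i = j then 1 else 0 :: nat" and ?r = "m(j := m j - 1)"
  have split_unique: "b = ?r" if "(?e, b) \<in> exp_splits m" for b
  proof
    fix i
    have "?e i + b i = m i"
      using that by (simp add: exp_splits_def)
    then show "b i = ?r i"
      by (auto split: if_splits)
  qed
  have "mps_coeff (mps_X j * f) m =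
      (\<Sum>s\<in>exp_splits m. if s = (?e, ?r) then mps_coeff f ?r else 0)"
    unfolding mps_coeff_mult
    by (rule sum.cong) (use split_unique in \<open>auto simp: mps_coeff_X split: if_splits\<close>)
  also have "\<dots> = (if (?e, ?r) \<in> exp_splits m then mps_coeff f ?r else 0)"
    by simp
  also have "(?e, ?r) \<in> exp_splits m \<longleftrightarrow> m j \<noteq> 0"
    by (auto simp: exp_splits_def)
  finally show ?thesis
    by simp
qed

definition mps_order_ge :: "nat \<Rightarrow> ('n::finite, 'k::comm_ring_1) mps set"
  where "mps_order_ge s = {f. \<forall>m. sum m UNIV < s \<longrightarrow> mps_coeff f m = 0}"

lemma mps_order_ge_0: "mps_order_ge 0 = UNIV"
  by (simp add: mps_order_ge_def)

lemma mps_order_ge_zero: "0 \<in> mps_order_ge s"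
  and mps_order_ge_add: "f \<in> mps_order_ge s \<Longrightarrow> g \<in> mps_order_ge s \<Longrightarrow> f + g \<in> mps_order_ge s"
  and mps_order_ge_uminus: "f \<in> mps_order_ge s \<Longrightarrow> - f \<in> mps_order_ge s"
  and mps_order_ge_diff: "f \<in> mps_order_ge s \<Longrightarrow> g \<in> mps_order_ge s \<Longrightarrow> f - g \<in> mps_order_ge s"
  and mps_order_ge_antimono: "s \<le> t \<Longrightarrow> f \<in> mps_order_ge t \<Longrightarrow> f \<in> mps_order_ge s"
  by (auto simp: mps_order_ge_def)

lemma mps_order_ge_all_imp_zero: "(\<And>s. f \<in> mps_order_ge s) \<Longrightarrow> f = 0"
  unfolding mps_order_ge_def by (rule mps_eqI) auto

lemma mps_order_ge_mult:
  assumes "f \<in> mps_order_ge s" "g \<in> mps_order_ge t"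
  shows "f * g \<in> mps_order_ge (s + t)"
proof -
  have "mps_coeff f a * mps_coeff g b = 0"
    if "sum m UNIV < s + t" "(a, b) \<in> exp_splits m" for m a b
  proof -
    have "sum m UNIV = sum a UNIV + sum b UNIV"
      using that(2) by (simp add: exp_splits_def flip: sum.distrib)
    then have "sum a UNIV < s \<or> sum b UNIV < t"
      using that(1) by linarith
    then show ?thesis
      using assms by (auto simp: mps_order_ge_def)
  qed
  then show ?thesis
    by (auto simp: mps_order_ge_def mps_coeff_mult split_beta intro!: sum.neutral)
qed

lemma mps_X_in_order_ge: "mps_X i \<in> mps_order_ge (Suc 0)"
  by (auto simp: mps_order_ge_def mps_coeff_X)

lemma mps_minus_const_in_order_ge: "f - mps_const (mps_coeff f (\<lambda>_. 0)) \<in> mps_order_ge (Suc 0)"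
proof -
  have "sum m UNIV < Suc 0 \<longleftrightarrow> m = (\<lambda>_. 0)" for m :: "'a \<Rightarrow> nat"
    by (auto simp: fun_eq_iff)
  then show ?thesis
    by (simp add: mps_order_ge_def mps_coeff_const)
qed

text \<open>Each monomial of \<open>f\<close> is charged to one of the variables dividing it.\<close>

lemma mps_order_ge_Suc_decompose:
  fixes f :: "('n::finite, 'k::comm_ring_1) mps"
  assumes "f \<in> mps_order_ge (Suc s)"
  obtains F where "\<And>i. F i \<in> mps_order_ge s" "f = (\<Sum>i\<in>UNIV. mps_X i * F i)"
proof -
  define v :: "('n \<Rightarrow> nat) \<Rightarrow> 'n" where "v m = (SOME i. m i \<noteq> 0)" for m
  have v: "m (v m) \<noteq> 0" if "m \<noteq> (\<lambda>_. 0)" for m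
    unfolding v_def using that by (intro someI_ex[of "\<lambda>i. m i \<noteq> 0"]) auto
  define F where
    "F i = Abs_mps (\<lambda>m. if v (m(i := m i + 1)) = i then mps_coeff f (m(i := m i + 1)) else 0)" for i
  have coeff_F: "mps_coeff (F i) m =
      (if v (m(i := m i + 1)) = i then mps_coeff f (m(i := m i + 1)) else 0)" for i m
    by (simp add: F_def Abs_mps_inverse)
  have "sum (m(i := m i + 1)) UNIV = sum m UNIV + 1" for i and m :: "'n \<Rightarrow> nat"
    by (simp add: sum.remove[of UNIV i])
  then have order_F: "F i \<in> mps_order_ge s" for i
    using assms by (auto simp: mps_order_ge_def coeff_F)
  have "mps_coeff f m = mps_coeff (\<Sum>i\<in>UNIV. mps_X i * F i) m" for m
  proof (cases "m = (\<lambda>_. 0)")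
    case True
    then show ?thesis
      using assms by (simp add: mps_order_ge_def mps_coeff_sum mps_coeff_X_mult)
  next
    case False
    have "mps_coeff (mps_X i * F i) m = (if i = v m then mps_coeff f m else 0)" for i
      using v[OF False] by (auto simp: mps_coeff_X_mult coeff_F)
    then show ?thesis
      by (simp add: mps_coeff_sum)
  qed
  then show thesis
    by (intro that[OF order_F] mps_eqI)
qed

lemma ideal_mps_order_ge:
  "ideal (mps_order_ge s) (mps_ring :: ('n::finite, 'k::comm_ring_1) mps ring)"
proof (rule idealI)
  interpret ring "mps_ring :: ('n, 'k) mps ring"
    by (rule ring_from_type_algebra)
  show "ring (mps_ring :: ('n, 'k) mps ring)"
    by (rule ring_axioms)
  show "subgroup (mps_order_ge s) (add_monoid (mps_ring :: ('n, 'k) mps ring))"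
    by (rule add.subgroupI)
      (auto simp: mps_order_ge_add mps_order_ge_uminus intro: mps_order_ge_zero
        simp flip: a_inv_def)
  fix f g :: "('n, 'k) mps"
  assume "f \<in> mps_order_ge s"
  then show "g \<otimes>\<^bsub>mps_ring\<^esub> f \<in> mps_order_ge s" "f \<otimes>\<^bsub>mps_ring\<^esub> g \<in> mps_order_ge s"
    using mps_order_ge_mult[of f s g 0] by (simp_all add: mps_order_ge_0 mult.commute)
qed

lemma ideal_mps_max: "ideal mps_max mps_ring"
  unfolding mps_max_def by (intro ring.genideal_ideal ring_from_type_algebra) simp

lemma mps_X_in_max: "mps_X i \<in> mps_max"
  unfolding mps_max_def
  using ring.genideal_self[OF ring_from_type_algebra, of "range mps_X"] by auto

lemma mps_max_subset_order_ge: "mps_max \<subseteq> mps_order_ge (Suc 0)"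
  unfolding mps_max_def
  by (rule ring.genideal_minimal[OF ring_from_type_algebra ideal_mps_order_ge])
    (auto intro: mps_X_in_order_ge)

lemma mps_max_prod_order_ge:
  "mps_max \<cdot>\<^bsub>mps_ring\<^esub> mps_order_ge s =
    (mps_order_ge (Suc s) :: ('n::finite, 'k::comm_ring_1) mps set)"
  (is "?P = _")
proof (intro equalityI subsetI)
  fix f :: "('n, 'k) mps"
  assume "f \<in> ?P"
  then show "f \<in> mps_order_ge (Suc s)"
  proof induction
    case (prod g h)
    then show ?case
      using mps_max_subset_order_ge mps_order_ge_mult[of g "Suc 0" h s] by auto
  qed (simp add: mps_order_ge_add)
next
  interpret P: additive_subgroup ?P mps_ring
    by (intro ideal.axioms(1) ring.ideal_prod_is_ideal ring_from_type_algebra ideal_mps_max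
        ideal_mps_order_ge)
  fix f :: "('n, 'k) mps"
  assume "f \<in> mps_order_ge (Suc s)"
  then obtain F where F: "\<And>i. F i \<in> mps_order_ge s" "f = (\<Sum>i\<in>UNIV. mps_X i * F i)"
    using mps_order_ge_Suc_decompose by blast
  have summand: "mps_X i * F i \<in> ?P" for i
    using ideal_prod.prod[OF mps_X_in_max F(1), where R = mps_ring] by simp
  have "(\<Sum>i\<in>I. mps_X i * F i) \<in> ?P" for I
    using P.a_closed P.zero_closed summand by (induction I rule: infinite_finite_induct) auto
  then show "f \<in> ?P"
    unfolding F(2) .
qed

lemma mps_max_pow_eq_order_ge: "mps_max_pow s = mps_order_ge s"
  by (induction s) (simp_all add: mps_order_ge_0 mps_max_prod_order_ge)

declare mps_max_pow.simps(2) [simp del]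

lemmas ideal_mps_max_pow = ideal_mps_order_ge[folded mps_max_pow_eq_order_ge]
  and mps_max_pow_zero [simp] = mps_order_ge_zero[folded mps_max_pow_eq_order_ge]
  and mps_max_pow_add = mps_order_ge_add[folded mps_max_pow_eq_order_ge]
  and mps_max_pow_uminus = mps_order_ge_uminus[folded mps_max_pow_eq_order_ge]
  and mps_max_pow_diff = mps_order_ge_diff[folded mps_max_pow_eq_order_ge]
  and mps_max_pow_antimono = mps_order_ge_antimono[folded mps_max_pow_eq_order_ge]
  and mps_max_pow_mult = mps_order_ge_mult[folded mps_max_pow_eq_order_ge]
  and mps_max_pow_all_imp_zero = mps_order_ge_all_imp_zero[folded mps_max_pow_eq_order_ge]
  and mps_X_in_max_pow = mps_X_in_order_ge[folded mps_max_pow_eq_order_ge]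
  and mps_minus_const_in_max_pow = mps_minus_const_in_order_ge[folded mps_max_pow_eq_order_ge]
  and mps_max_pow_Suc_decompose = mps_order_ge_Suc_decompose[folded mps_max_pow_eq_order_ge]

lemma mps_max_pow_sum:
  "(\<And>i. i \<in> I \<Longrightarrow> F i \<in> mps_max_pow s) \<Longrightarrow> (\<Sum>i\<in>I. F i) \<in> mps_max_pow s"
  by (induction I rule: infinite_finite_induct) (auto intro: mps_max_pow_add)


section \<open>Partial derivatives and the chain rule\<close>

lemma mps_pderiv_add: "mps_pderiv j (f + g) = mps_pderiv j f + mps_pderiv j g"
  for f g :: "('n::finite, 'k::comm_ring_1) mps"
  by (rule mps_eqI) (simp add: mps_coeff_pderiv distrib_left)

lemma mps_pderiv_const: "mps_pderiv j (mps_const c) = (0 :: ('n::finite, 'k::comm_ring_1) mps)"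
proof (rule mps_eqI)
  fix m :: "'n \<Rightarrow> nat"
  have "m(j := m j + 1) \<noteq> (\<lambda>_. 0)"
    by (metis add_is_0 fun_upd_same one_neq_zero)
  then show "mps_coeff (mps_pderiv j (mps_const c)) m = mps_coeff (0 :: ('n, 'k) mps) m"
    by (simp add: mps_coeff_pderiv mps_coeff_const)
qed

lemma mps_pderiv_X:
  "mps_pderiv j (mps_X i) = (if i = j then 1 else 0 :: ('n::finite, 'k::comm_ring_1) mps)"
proof (rule mps_eqI)
  fix m :: "'n \<Rightarrow> nat"
  have "m(j := m j + 1) = (\<lambda>l. if l = i then 1 else 0) \<longleftrightarrow> i = j \<and> m = (\<lambda>_. 0)"
    by (auto simp: fun_eq_iff split: if_splits)
  then show "mps_coeff (mps_pderiv j (mps_X i)) m =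
      mps_coeff (if i = j then 1 else 0 :: ('n, 'k) mps) m"
    by (simp add: mps_coeff_pderiv mps_coeff_X)
qed

lemma sum_exp_splits_pderiv:
  fixes f g :: "('n::finite, 'k::comm_ring_1) mps"
  shows "(\<Sum>(a, b)\<in>exp_splits (m(j := m j + 1)). of_nat (a j) * (mps_coeff f a * mps_coeff g b)) =
    mps_coeff (mps_pderiv j f * g) m"
proof -
  let ?m = "m(j := m j + 1)"
  let ?S = "{s \<in> exp_splits ?m. fst s j \<noteq> 0}"
  have "(\<Sum>(a, b)\<in>exp_splits ?m. of_nat (a j) * (mps_coeff f a * mps_coeff g b)) =
      (\<Sum>(a, b)\<in>?S. of_nat (a j) * (mps_coeff f a * mps_coeff g b))"
    by (rule sum.mono_neutral_right) (auto intro!: gr0I)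
  also have "\<dots> = mps_coeff (mps_pderiv j f * g) m"
    unfolding mps_coeff_mult
    by (rule sum.reindex_bij_witness
        [where i = "\<lambda>(a, b). (a(j := a j + 1), b)" and j = "\<lambda>(a, b). (a(j := a j - 1), b)"])
      (auto simp: exp_splits_def mps_coeff_pderiv of_nat_diff mult.assoc split: if_splits)
  finally show ?thesis .
qed

lemma mps_pderiv_mult:
  fixes f g :: "('n::finite, 'k::comm_ring_1) mps"
  shows "mps_pderiv j (f * g) = mps_pderiv j f * g + f * mps_pderiv j g"
proof (rule mps_eqI)
  fix m :: "'n \<Rightarrow> nat"
  let ?m = "m(j := m j + 1)"
  have "mps_coeff (mps_pderiv j (f * g)) m =
      (\<Sum>(a, b)\<in>exp_splits ?m. of_nat (a j + b j) * (mps_coeff f a * mps_coeff g b))"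
    unfolding mps_coeff_pderiv mps_coeff_mult sum_distrib_left
    by (rule sum.cong)
      (auto simp: exp_splits_def simp del: of_nat_add of_nat_Suc dest!: spec[of _ j])
  also have "\<dots> = (\<Sum>(a, b)\<in>exp_splits ?m. of_nat (a j) * (mps_coeff f a * mps_coeff g b)) +
      (\<Sum>(a, b)\<in>exp_splits ?m. of_nat (b j) * (mps_coeff g b * mps_coeff f a))"
    by (simp add: split_beta algebra_simps flip: sum.distrib)
  also have "(\<Sum>(a, b)\<in>exp_splits ?m. of_nat (b j) * (mps_coeff g b * mps_coeff f a)) =
      (\<Sum>(a, b)\<in>exp_splits ?m. of_nat (a j) * (mps_coeff g a * mps_coeff f b))"
    by (rule sum.reindex_bij_witness[where i = prod.swap and j = prod.swap])
      (auto simp: exp_splits_def add.commute)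
  finally show "mps_coeff (mps_pderiv j (f * g)) m =
      mps_coeff (mps_pderiv j f * g + f * mps_pderiv j g) m"
    by (simp only: sum_exp_splits_pderiv mps_coeff_simps mult.commute[of "mps_pderiv j g" f])
qed

locale adic_endomorphism =
  fixes g :: "('n::finite, 'k::comm_ring_1) mps_map"
  assumes add: "g (f + h) = g f + g h"
    and mult: "g (f * h) = g f * g h"
    and const: "g (mps_const c) = mps_const c"
    and X: "g (mps_X i) \<in> mps_max_pow (Suc 0)"
begin

lemma zero [simp]: "g 0 = 0"
  using const[of 0] by (simp add: zero_mps_def)

lemma one [simp]: "g 1 = 1"
  using const[of 1] by (simp add: one_mps_def)

lemma minus: "g (- f) = - g f"
  using add[of f "- f"] by (simp add: eq_neg_iff_add_eq_0 add.commute)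

lemma diff: "g (f - h) = g f - g h"
  using add[of f "- h"] by (simp add: minus)

lemma sum: "g (\<Sum>i\<in>I. F i) = (\<Sum>i\<in>I. g (F i))"
  by (induction I rule: infinite_finite_induct) (auto simp: add)

lemma prod: "g (\<Prod>i\<in>I. F i) = (\<Prod>i\<in>I. g (F i))"
  by (induction I rule: infinite_finite_induct) (auto simp: mult)

lemma of_int: "g (of_int n) = of_int n"
proof -
  have of_nat: "g (of_nat m) = of_nat m" for m
    by (induction m) (auto simp: add)
  show ?thesis
    by (cases n rule: int_cases2) (auto simp: minus of_nat)
qed

lemma max_pow: "f \<in> mps_max_pow s \<Longrightarrow> g f \<in> mps_max_pow s"
proof (induction s arbitrary: f)
  case (Suc s)
  then obtain F where "\<And>i. F i \<in> mps_max_pow s" "f = (\<Sum>i\<in>UNIV. mps_X i * F i)"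
    using mps_max_pow_Suc_decompose by blast
  then show ?case
    using mps_max_pow_mult[OF X Suc.IH] by (auto simp: sum mult intro!: mps_max_pow_sum)
qed simp

lemma adic_continuous: "adic_continuous g"
  unfolding adic_continuous_def by (metis diff max_pow)

text \<open>Splitting off the constant term and a factor \<open>x\<^sub>i\<close> from every other monomial shows, step by
  step, that such a derivation maps into every power of the maximal ideal.\<close>

lemma derivation_along_eq_0:
  assumes D_add: "\<And>f h. D (f + h) = D f + D h"
    and D_mult: "\<And>f h. D (f * h) = D f * g h + g f * D h"
    and D_const: "\<And>c. D (mps_const c) = 0" and D_X: "\<And>i. D (mps_X i) = 0"
  shows "D f = 0"
proof (rule mps_max_pow_all_imp_zero)
  have D_sum: "D (\<Sum>i\<in>I. F i) = (\<Sum>i\<in>I. D (F i))" for I :: "'n set" and F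
    using D_const[of 0]
    by (induction I rule: infinite_finite_induct) (auto simp: D_add zero_mps_def)
  show "D f \<in> mps_max_pow s" for s
  proof (induction s arbitrary: f)
    case (Suc s)
    obtain F where F: "f - mps_const (mps_coeff f (\<lambda>_. 0)) = (\<Sum>i\<in>UNIV. mps_X i * F i)"
      using mps_max_pow_Suc_decompose[OF mps_minus_const_in_max_pow] by blast
    have "D f = D (mps_const (mps_coeff f (\<lambda>_. 0)) + (\<Sum>i\<in>UNIV. mps_X i * F i))"
      by (simp flip: F)
    also have "\<dots> = (\<Sum>i\<in>UNIV. g (mps_X i) * D (F i))"
      by (simp add: D_add D_const D_sum D_mult D_X)
    also have "\<dots> \<in> mps_max_pow (Suc s)"
      using mps_max_pow_mult[OF X Suc] by (auto intro: mps_max_pow_sum)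
    finally show ?case .
  qed simp
qed

lemma pderiv_chain:
  "mps_pderiv j (g f) = (\<Sum>l\<in>UNIV. g (mps_pderiv l f) * mps_pderiv j (g (mps_X l)))"
proof -
  define D where
    "D f = mps_pderiv j (g f) - (\<Sum>l\<in>UNIV. g (mps_pderiv l f) * mps_pderiv j (g (mps_X l)))" for f
  have "D f = 0"
  proof (rule derivation_along_eq_0[of D])
    show "D (f + h) = D f + D h" for f h
      by (simp add: D_def add mps_pderiv_add distrib_right sum.distrib)
    show "D (f * h) = D f * g h + g f * D h" for f h
      by (simp add: D_def add mult mps_pderiv_add mps_pderiv_mult distrib_right sum.distrib
          sum_distrib_left algebra_simps)
    show "D (mps_const c) = 0" for c
      by (simp add: D_def const mps_pderiv_const)
    show "D (mps_X i) = 0" for i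
      by (simp add: D_def mps_pderiv_X if_distrib[of g] if_distrib[of "\<lambda>x. x * _"] cong: if_cong)
  qed
  then show ?thesis
    by (simp add: D_def)
qed

lemma det_jacobian_comp: "det (jacobian (g \<circ> h)) = g (det (jacobian h)) * det (jacobian g)"
proof -
  have "jacobian (g \<circ> h) = (\<chi> i j. g (mps_pderiv j (h (mps_X i)))) ** jacobian g"
    by (simp add: jacobian_def matrix_matrix_mult_def vec_eq_iff pderiv_chain[of _ "h _"])
  moreover have "det (\<chi> i j. g (mps_pderiv j (h (mps_X i)))) = g (det (jacobian h))"
    by (simp add: det_def jacobian_def sum mult prod of_int)
  ultimately show ?thesis
    by (simp add: det_mul)
qed

lemma sum_diff_decomposition:
  "g (\<Sum>i\<in>UNIV. mps_X i * F i) - (\<Sum>i\<in>UNIV. mps_X i * F i) =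
    (\<Sum>i\<in>UNIV. (g (mps_X i) - mps_X i) * g (F i) + mps_X i * (g (F i) - F i))"
  by (simp add: sum mult left_diff_distrib right_diff_distrib sum.distrib sum_subtractf)

lemma diff_in_max_pow:
  assumes shift_X: "\<And>j. g (mps_X j) - mps_X j \<in> mps_max_pow s"
  shows "g f - f \<in> mps_max_pow s"
proof -
  have "g f - f \<in> mps_max_pow t" if "t \<le> s" for t f
    using that
  proof (induction t arbitrary: f)
    case (Suc t)
    let ?c = "mps_const (mps_coeff f (\<lambda>_. 0))"
    obtain F where F: "f - ?c = (\<Sum>i\<in>UNIV. mps_X i * F i)"
      using mps_max_pow_Suc_decompose[OF mps_minus_const_in_max_pow] by blast
    have "(g (mps_X i) - mps_X i) * g (F i) \<in> mps_max_pow (Suc t)" for i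
      using mps_max_pow_mult[OF shift_X, of "g (F i)" 0]
      by (intro mps_max_pow_antimono[OF Suc.prems]) simp
    moreover have "mps_X i * (g (F i) - F i) \<in> mps_max_pow (Suc t)" for i
      using mps_max_pow_mult[OF mps_X_in_max_pow Suc.IH] Suc.prems by simp
    ultimately have "g (f - ?c) - (f - ?c) \<in> mps_max_pow (Suc t)"
      unfolding F sum_diff_decomposition by (intro mps_max_pow_sum mps_max_pow_add)
    then show ?case
      by (simp add: diff const)
  qed simp
  then show ?thesis
    by blast
qed

lemma diff_raises_max_pow:
  assumes shift_X: "\<And>j. g (mps_X j) - mps_X j \<in> mps_max_pow (Suc a)"
  shows "f \<in> mps_max_pow q \<Longrightarrow> g f - f \<in> mps_max_pow (q + a)"
proof (induction q arbitrary: f)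
  case 0
  show ?case
    using diff_in_max_pow[OF shift_X] by (rule mps_max_pow_antimono[rotated]) simp
next
  case (Suc q)
  obtain F where F: "\<And>i. F i \<in> mps_max_pow q" "f = (\<Sum>i\<in>UNIV. mps_X i * F i)"
    using mps_max_pow_Suc_decompose[OF Suc.prems] by blast
  have "(g (mps_X i) - mps_X i) * g (F i) \<in> mps_max_pow (Suc q + a)" for i
    using mps_max_pow_mult[OF shift_X max_pow[OF F(1)]] by (simp add: add.commute)
  moreover have "mps_X i * (g (F i) - F i) \<in> mps_max_pow (Suc q + a)" for i
    using mps_max_pow_mult[OF mps_X_in_max_pow Suc.IH[OF F(1)]] by simp
  ultimately show ?case
    unfolding F(2) sum_diff_decomposition by (intro mps_max_pow_sum mps_max_pow_add)
qed

end


section \<open>The group of volume-preserving automorphisms\<close>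

locale unipotent_automorphism = adic_endomorphism +
  assumes bij: "bij g"
    and shift_X: "g (mps_X j) - mps_X j \<in> mps_max_pow 2"
begin

lemma diff_in_max_pow_Suc:
  assumes "f \<in> mps_max_pow q"
  shows "g f - f \<in> mps_max_pow (Suc q)"
  using diff_raises_max_pow[of 1 f q] shift_X assms by (simp add: numeral_2_eq_2)

lemma max_pow_iff: "g f \<in> mps_max_pow s \<longleftrightarrow> f \<in> mps_max_pow s"
proof
  assume "g f \<in> mps_max_pow s"
  then show "f \<in> mps_max_pow s"
  proof (induction s)
    case (Suc s)
    then have "f \<in> mps_max_pow s"
      using mps_max_pow_antimono[of s "Suc s" "g f"] by simp
    then have "g f - f \<in> mps_max_pow (Suc s)"
      by (rule diff_in_max_pow_Suc)
    from mps_max_pow_diff[OF Suc.prems this] show ?case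
      by simp
  qed simp
qed (rule max_pow)

lemma apply_inv: "g (inv_into UNIV g f) = f"
  and inv_apply: "inv_into UNIV g (g f) = f"
  using bij by (simp_all add: bij_is_surj surj_f_inv_f bij_is_inj)

lemma inv_max_pow: "f \<in> mps_max_pow s \<Longrightarrow> inv_into UNIV g f \<in> mps_max_pow s"
  using max_pow_iff[of "inv_into UNIV g f" s] by (simp add: apply_inv)

lemma adic_endomorphism_inv: "adic_endomorphism (inv_into UNIV g)"
proof
  show "inv_into UNIV g (f + h) = inv_into UNIV g f + inv_into UNIV g h" for f h
    by (metis add apply_inv inv_apply)
  show "inv_into UNIV g (f * h) = inv_into UNIV g f * inv_into UNIV g h" for f h
    by (metis mult apply_inv inv_apply)
  show "inv_into UNIV g (mps_const c) = mps_const c" for c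
    by (metis const inv_apply)
qed (intro inv_max_pow mps_X_in_max_pow)

lemma unipotent_automorphism_inv: "unipotent_automorphism (inv_into UNIV g)"
proof (intro unipotent_automorphism.intro unipotent_automorphism_axioms.intro adic_endomorphism_inv)
  interpret inv: adic_endomorphism "inv_into UNIV g"
    by (rule adic_endomorphism_inv)
  show "bij (inv_into UNIV g)"
    using bij by (rule bij_imp_bij_inv)
  show "inv_into UNIV g (mps_X j) - mps_X j \<in> mps_max_pow 2" for j
    using mps_max_pow_uminus[OF inv_max_pow[OF shift_X[of j]]] by (simp add: inv.diff inv_apply)
qed

lemma unipotent_automorphism_comp:
  assumes "unipotent_automorphism h"
  shows "unipotent_automorphism (g \<circ> h)"
proof -
  interpret h: unipotent_automorphism h
    by (rule assms)
  show ?thesis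
  proof
    have "(g \<circ> h) (mps_X j) - mps_X j = g (h (mps_X j) - mps_X j) + (g (mps_X j) - mps_X j)" for j
      by (simp add: diff)
    then show "(g \<circ> h) (mps_X j) - mps_X j \<in> mps_max_pow 2" for j
      using mps_max_pow_add[OF max_pow[OF h.shift_X] shift_X] by (simp only:)
    show "bij (g \<circ> h)"
      using bij h.bij by (simp add: bij_comp)
  qed (simp_all add: add mult const h.add h.mult h.const max_pow h.X)
qed

end

lemma unipotent_automorphism_id: "unipotent_automorphism id"
  by unfold_locales (simp_all add: mps_X_in_max_pow)

lemma vol_group_simps [simp]: "g \<otimes>\<^bsub>vol_group\<^esub> h = g \<circ> h" "\<one>\<^bsub>vol_group\<^esub> = id"
  by (simp_all add: vol_group_def)

lemma vol_group_carrier_iff: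
  "g \<in> carrier vol_group \<longleftrightarrow> unipotent_automorphism g \<and> det (jacobian g) = 1"
proof
  assume g: "g \<in> carrier vol_group"
  then have iso: "g \<in> ring_iso mps_ring mps_ring" and const: "\<And>c. g (mps_const c) = mps_const c"
    and X: "\<And>j. g (mps_X j) - mps_X j \<in> mps_max_pow 2" and det: "det (jacobian g) = 1"
    by (auto simp: vol_group_def continuous_automorphisms_def)
  have "unipotent_automorphism g"
  proof
    show "g (mps_X i) \<in> mps_max_pow (Suc 0)" for i
      using mps_max_pow_add[OF mps_max_pow_antimono[OF _ X[of i]] mps_X_in_max_pow[of i]] by simp
  qed (use ring_iso_memE(2,3,5)[OF iso] const X in auto)
  then show "unipotent_automorphism g \<and> det (jacobian g) = 1"
    using det by simp
next
  assume g: "unipotent_automorphism g \<and> det (jacobian g) = 1"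
  then interpret unipotent_automorphism g
    by simp
  have "g \<in> ring_iso mps_ring mps_ring"
    using bij by (intro ring_iso_memI) (auto simp: add mult)
  then show "g \<in> carrier vol_group"
    using g const shift_X adic_continuous by (simp add: vol_group_def continuous_automorphisms_def)
qed

lemma vol_group_unipotent: "g \<in> carrier vol_group \<Longrightarrow> unipotent_automorphism g"
  by (simp add: vol_group_carrier_iff)

lemma vol_group_endomorphism: "g \<in> carrier vol_group \<Longrightarrow> adic_endomorphism g"
  by (rule unipotent_automorphism.axioms(1)[OF vol_group_unipotent])

lemma jacobian_id: "jacobian id = (mat 1 :: ('n::finite, 'k::comm_ring_1) mps ^ 'n ^ 'n)"
  by (simp add: jacobian_def mat_def mps_pderiv_X vec_eq_iff)

lemma vol_group_id_closed: "id \<in> carrier vol_group"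
  by (simp add: vol_group_carrier_iff unipotent_automorphism_id jacobian_id)

lemma vol_group_comp_closed:
  assumes "g \<in> carrier vol_group" "h \<in> carrier vol_group"
  shows "g \<circ> h \<in> carrier vol_group"
  using assms adic_endomorphism.det_jacobian_comp[OF vol_group_endomorphism[OF assms(1)], of h]
    adic_endomorphism.one[OF vol_group_endomorphism[OF assms(1)]]
  by (simp add: vol_group_carrier_iff unipotent_automorphism.unipotent_automorphism_comp)

lemma vol_group_inv_into_closed:
  assumes "g \<in> carrier vol_group"
  shows "inv_into UNIV g \<in> carrier vol_group"
proof -
  interpret g: unipotent_automorphism g
    using assms by (rule vol_group_unipotent)
  interpret inv: adic_endomorphism "inv_into UNIV g"
    by (rule g.adic_endomorphism_inv)
  have "inv_into UNIV g \<circ> g = id"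
    by (simp add: fun_eq_iff g.inv_apply)
  then have "inv_into UNIV g (det (jacobian g)) * det (jacobian (inv_into UNIV g)) = 1"
    by (metis inv.det_jacobian_comp jacobian_id det_I)
  then show ?thesis
    using assms by (simp add: vol_group_carrier_iff g.unipotent_automorphism_inv)
qed

lemma vol_group_inverse:
  assumes "g \<in> carrier vol_group"
  shows "g (inv_into UNIV g f) = f" "inv_into UNIV g (g f) = f"
  using vol_group_unipotent[OF assms]
  by (simp_all add: unipotent_automorphism.apply_inv unipotent_automorphism.inv_apply)

interpretation vol_group: group "vol_group :: ('n::finite, 'k::comm_ring_1) mps_map monoid"
proof (rule groupI)
  fix g :: "('n, 'k) mps_map"
  assume "g \<in> carrier vol_group"
  then show "\<exists>h\<in>carrier vol_group. h \<otimes>\<^bsub>vol_group\<^esub> g = \<one>\<^bsub>vol_group\<^esub>"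
    by (intro bexI[of _ "inv_into UNIV g"]) (auto simp: vol_group_inverse vol_group_inv_into_closed)
qed (auto simp: vol_group_comp_closed vol_group_id_closed comp_assoc)

lemma vol_group_m_inv: "g \<in> carrier vol_group \<Longrightarrow> inv\<^bsub>vol_group\<^esub> g = inv_into UNIV g"
  by (intro vol_group.inv_equality) (auto simp: vol_group_inverse vol_group_inv_into_closed)

lemma vol_subgroup_iff_diff:
  "g \<in> vol_subgroup s \<longleftrightarrow> g \<in> carrier vol_group \<and> (\<forall>f. g f - f \<in> mps_max_pow s)"
  using adic_endomorphism.diff_in_max_pow[OF vol_group_endomorphism]
  by (auto simp: vol_subgroup_def)

lemma vol_subgroup_raises_max_pow:
  assumes "g \<in> vol_subgroup (Suc a)" "f \<in> mps_max_pow q"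
  shows "g f - f \<in> mps_max_pow (q + a)"
  using assms adic_endomorphism.diff_raises_max_pow[OF vol_group_endomorphism, of g a f q]
  by (simp add: vol_subgroup_def)

lemma vol_subgroup_le_2: "s \<le> 2 \<Longrightarrow> vol_subgroup s = carrier vol_group"
  using mps_max_pow_antimono[OF _ unipotent_automorphism.shift_X[OF vol_group_unipotent]]
  by (auto simp: vol_subgroup_def)

lemma vol_subgroup_antimono: "s \<le> t \<Longrightarrow> vol_subgroup t \<subseteq> vol_subgroup s"
  by (auto simp: vol_subgroup_def intro: mps_max_pow_antimono)

lemma id_in_vol_subgroup: "id \<in> vol_subgroup s"
  by (simp add: vol_subgroup_iff_diff vol_group_id_closed)

lemma vol_subgroup_is_subgroup: "subgroup (vol_subgroup s) vol_group"
proof (rule vol_group.subgroupI)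
  fix g h :: "('a, 'b) mps_map"
  assume g: "g \<in> vol_subgroup s"
  then have g_closed: "g \<in> carrier vol_group"
    by (simp add: vol_subgroup_def)
  have "inv_into UNIV g f - f \<in> mps_max_pow s" for f
  proof -
    have "g (inv_into UNIV g f) - inv_into UNIV g f \<in> mps_max_pow s"
      using g by (simp add: vol_subgroup_iff_diff)
    from mps_max_pow_uminus[OF this] show ?thesis
      by (simp add: vol_group_inverse[OF g_closed])
  qed
  then show "inv\<^bsub>vol_group\<^esub> g \<in> vol_subgroup s"
    using g_closed by (simp add: vol_subgroup_iff_diff vol_group_m_inv vol_group_inv_into_closed)
  assume h: "h \<in> vol_subgroup s"
  have "g (h f) - f \<in> mps_max_pow s" for f
    using g h mps_max_pow_add[of "g (h f) - h f" s "h f - f"] by (simp add: vol_subgroup_iff_diff)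
  then show "g \<otimes>\<^bsub>vol_group\<^esub> h \<in> vol_subgroup s"
    using g h by (simp add: vol_subgroup_iff_diff vol_group_comp_closed)
qed (use id_in_vol_subgroup in \<open>auto simp: vol_subgroup_def\<close>)

lemma vol_subgroup_normal: "vol_subgroup s \<lhd> vol_group"
  unfolding vol_group.normal_inv_iff
proof (intro conjI ballI vol_subgroup_is_subgroup)
  fix h g :: "('a, 'b) mps_map"
  assume h: "h \<in> carrier vol_group" and g: "g \<in> vol_subgroup s"
  interpret h: adic_endomorphism h
    using h by (rule vol_group_endomorphism)
  have "h (g (inv_into UNIV h f)) - f \<in> mps_max_pow s" for f
  proof -
    have "h (g (inv_into UNIV h f)) - f = h (g (inv_into UNIV h f) - inv_into UNIV h f)"
      by (simp add: h.diff vol_group_inverse[OF h])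
    then show ?thesis
      using g by (simp add: vol_subgroup_iff_diff h.max_pow)
  qed
  then show "h \<otimes>\<^bsub>vol_group\<^esub> g \<otimes>\<^bsub>vol_group\<^esub> inv\<^bsub>vol_group\<^esub> h \<in> vol_subgroup s"
    using g h by (simp add: vol_subgroup_iff_diff vol_group_m_inv[OF h] vol_group_comp_closed
        vol_group_inv_into_closed)
qed


section \<open>Groups and rings of jets\<close>

abbreviation map_jet :: "nat \<Rightarrow> ('n::finite, 'k::comm_ring_1) mps_map \<Rightarrow> ('n, 'k) mps_map set"
  where "map_jet N g \<equiv> vol_subgroup N #>\<^bsub>vol_group\<^esub> g"

abbreviation jet :: "nat \<Rightarrow> ('n::finite, 'k::comm_ring_1) mps \<Rightarrow> ('n, 'k) mps set"
  where "jet N f \<equiv> mps_max_pow N +>\<^bsub>mps_ring\<^esub> f"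

lemma map_jet_eq:
  assumes g: "g \<in> carrier vol_group"
  shows "map_jet N g = {h \<in> carrier vol_group. \<forall>f. h f - g f \<in> mps_max_pow N}"
proof -
  have "h \<circ> inv_into UNIV g \<in> vol_subgroup N \<longleftrightarrow> (\<forall>f. h f - g f \<in> mps_max_pow N)"
    if "h \<in> carrier vol_group" for h
  proof -
    have "(\<forall>f. h (inv_into UNIV g f) - f \<in> mps_max_pow N) \<longleftrightarrow> (\<forall>f. h f - g f \<in> mps_max_pow N)"
      by (metis vol_group_inverse[OF g])
    then show ?thesis
      using g that
      by (simp add: vol_subgroup_iff_diff vol_group_comp_closed vol_group_inv_into_closed)
  qed
  moreover have "map_jet N g \<subseteq> carrier vol_group"
    using vol_group.r_coset_subset_G[OF subgroup.subset[OF vol_subgroup_is_subgroup] g] .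
  ultimately show ?thesis
    using subgroup.rcos_module[OF vol_subgroup_is_subgroup vol_group.group_axioms g] g
    by (auto simp: vol_group_m_inv subset_iff)
qed

lemma map_jet_self: "g \<in> carrier vol_group \<Longrightarrow> g \<in> map_jet N g"
  by (simp add: map_jet_eq)

lemma map_jet_eqI: "\<lbrakk>g \<in> carrier vol_group; h \<in> map_jet N g\<rbrakk> \<Longrightarrow> map_jet N h = map_jet N g"
  by (rule vol_group.repr_independence[OF _ _ vol_subgroup_is_subgroup, symmetric])

lemma jet_group_group: "group (jet_group N)"
  unfolding jet_group_def by (rule normal.factorgroup_is_group[OF vol_subgroup_normal])

lemma carrier_jet_group: "carrier (jet_group N) = map_jet N ` carrier vol_group"
  by (simp add: jet_group_def carrier_FactGroup)

lemma jet_group_one: "\<one>\<^bsub>jet_group N\<^esub> = map_jet N id"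
  unfolding jet_group_def one_FactGroup
  by (rule vol_group.coset_join2[symmetric])
    (intro vol_group_id_closed vol_subgroup_is_subgroup id_in_vol_subgroup)+

lemma jet_group_mult:
  assumes "g \<in> carrier vol_group" "h \<in> carrier vol_group"
  shows "map_jet N g \<otimes>\<^bsub>jet_group N\<^esub> map_jet N h = map_jet N (g \<circ> h)"
  using normal.rcos_sum[OF vol_subgroup_normal assms] by (simp add: jet_group_def)

text \<open>\<open>G\<^sub>s\<close> becomes trivial in \<open>T\<^sub>N\<close> for \<open>s \<ge> N\<close>, hence the minimum.\<close>

lemma map_jet_in_jet_subgroup_iff:
  assumes g: "g \<in> carrier vol_group"
  shows "map_jet N g \<in> jet_subgroup N s \<longleftrightarrow> g \<in> vol_subgroup (min s N)"
proof
  assume "map_jet N g \<in> jet_subgroup N s"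
  then obtain h where h: "h \<in> vol_subgroup s" "map_jet N g = map_jet N h"
    by (auto simp: jet_subgroup_def)
  then obtain u where "u \<in> vol_subgroup N" "g = u \<circ> h"
    using map_jet_self[OF g, of N] by (auto simp: r_coset_def)
  then show "g \<in> vol_subgroup (min s N)"
    using h(1) vol_subgroup_antimono[of "min s N" s] vol_subgroup_antimono[of "min s N" N]
      subgroup.m_closed[OF vol_subgroup_is_subgroup, of u "min s N" h] by auto
next
  assume g': "g \<in> vol_subgroup (min s N)"
  show "map_jet N g \<in> jet_subgroup N s"
  proof (cases "s \<le> N")
    case True
    then show ?thesis
      using g' by (auto simp: jet_subgroup_def)
  next
    case False
    then have "map_jet N g = map_jet N id"
      using g' map_jet_eqI[OF vol_group_id_closed, of g N]
      by (simp add: map_jet_eq[OF vol_group_id_closed] vol_subgroup_iff_diff)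
    then show ?thesis
      using id_in_vol_subgroup by (auto simp: jet_subgroup_def)
  qed
qed

lemma jet_quotient_map_jet:
  assumes g: "g \<in> carrier vol_group" and "N \<le> N'"
  shows "jet_quotient N (map_jet N' g) = map_jet N g"
proof -
  have "map_jet N h = map_jet N g" if "h \<in> map_jet N' g" for h
    using that mps_max_pow_antimono[OF assms(2)]
    by (intro map_jet_eqI[OF g]) (auto simp: map_jet_eq[OF g])
  then have "map_jet N ` map_jet N' g = {map_jet N g}"
    using map_jet_self[OF g, of N'] by blast
  then show ?thesis
    by (simp add: jet_quotient_def)
qed

lemma jet_eq: "jet N f = {h. h - f \<in> mps_max_pow N}"
  unfolding a_r_coset_def' by (auto intro!: exI[of _ "_ - f"])

lemma jet_eq_iff: "jet N f = jet N h \<longleftrightarrow> f - h \<in> mps_max_pow N"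
  using ring.quotient_eq_iff_same_a_r_cos[OF ring_from_type_algebra ideal_mps_max_pow, of f h N]
  by simp

lemma jet_ring_hom: "ring_hom_ring mps_ring (jet_ring N) (jet N)"
  unfolding jet_ring_def by (rule ideal.rcos_ring_hom_ring[OF ideal_mps_max_pow])

lemma abelian_group_jet_ring: "abelian_group (jet_ring N)"
  by (rule ring.is_abelian_group[OF ring_hom_ring.axioms(2)[OF jet_ring_hom]])

lemma carrier_jet_ring: "carrier (jet_ring N) = range (jet N)"
  by (auto simp: jet_ring_def FactRing_def A_RCOSETS_def')

lemma jet_hom: "abelian_group_hom mps_ring (jet_ring N) (jet N)"
proof -
  interpret ring_hom_ring mps_ring "jet_ring N" "jet N"
    by (rule jet_ring_hom)
  show ?thesis
    by (rule abelian_group_hom_axioms)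
qed

lemma jet_add: "jet N f \<oplus>\<^bsub>jet_ring N\<^esub> jet N h = jet N (f + h)"
  using abelian_group_hom.hom_add[OF jet_hom, of f h N] by simp

lemma jet_minus: "jet N f \<ominus>\<^bsub>jet_ring N\<^esub> jet N h = jet N (f - h)"
  using abelian_group_hom.hom_a_inv[OF jet_hom, of h N] jet_add[of N f "- h"]
  by (simp add: a_minus_def)

lemma jet_filtration_eq:
  "jet_filtration N q = (jet N ` mps_max_pow q :: ('n::finite, 'k::comm_ring_1) mps set set)"
proof (intro equalityI subsetI)
  fix b :: "('n, 'k) mps set"
  assume "b \<in> jet_filtration N q"
  then obtain f u where "f \<in> mps_max_pow q" "u \<in> mps_max_pow N" "b = jet N (f + u)"
    by (auto simp: jet_filtration_def set_add_def')
  moreover from this(2) have "jet N (f + u) = jet N f"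
    by (simp add: jet_eq_iff)
  ultimately show "b \<in> jet N ` mps_max_pow q"
    by blast
next
  fix b :: "('n, 'k) mps set"
  assume "b \<in> jet N ` mps_max_pow q"
  then obtain f where f: "f \<in> mps_max_pow q" "b = jet N (f + 0)"
    by auto
  then have "f + 0 \<in> mps_max_pow q <+>\<^bsub>mps_ring\<^esub> mps_max_pow N"
    unfolding set_add_def' type_ring_simps using mps_max_pow_zero by blast
  then show "b \<in> jet_filtration N q"
    unfolding jet_filtration_def f(2) by (rule imageI)
qed

lemma jet_in_filtration_iff: "jet N f \<in> jet_filtration N q \<longleftrightarrow> f \<in> mps_max_pow (min q N)"
proof
  assume "jet N f \<in> jet_filtration N q"
  then obtain h where h: "h \<in> mps_max_pow q" "f - h \<in> mps_max_pow N"
    by (auto simp: jet_filtration_eq jet_eq_iff)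
  then show "f \<in> mps_max_pow (min q N)"
    using mps_max_pow_add[of "f - h" "min q N" h]
      mps_max_pow_antimono[of "min q N" q h] mps_max_pow_antimono[of "min q N" N "f - h"] by simp
next
  assume f: "f \<in> mps_max_pow (min q N)"
  show "jet N f \<in> jet_filtration N q"
  proof (cases "q \<le> N")
    case True
    then show ?thesis
      using f by (simp add: jet_filtration_eq)
  next
    case False
    then have "jet N f = jet N 0"
      using f by (simp add: jet_eq_iff)
    then show ?thesis
      by (simp add: jet_filtration_eq)
  qed
qed

lemma jet_action_jet:
  assumes g: "g \<in> carrier vol_group"
  shows "jet_action N (map_jet N g) (jet N f) = jet N (g f)"
proof -
  have "jet N (h f') = jet N (g f)" if "h \<in> map_jet N g" "f' \<in> jet N f" for h f'
  proof -
    have "h \<in> carrier vol_group" and h: "h f - g f \<in> mps_max_pow N"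
      using that(1) by (simp_all add: map_jet_eq[OF g])
    then interpret h: adic_endomorphism h
      by (intro vol_group_endomorphism)
    have "h (f' - f) \<in> mps_max_pow N"
      using that(2) by (intro h.max_pow) (simp add: jet_eq)
    from mps_max_pow_add[OF this h] show ?thesis
      by (simp add: jet_eq_iff h.diff)
  qed
  moreover have "g \<in> map_jet N g" "f \<in> jet N f"
    using map_jet_self[OF g] by (auto simp: jet_eq)
  ultimately have "{jet N (h f') | h f'. h \<in> map_jet N g \<and> f' \<in> jet N f} = {jet N (g f)}"
    by blast
  then show ?thesis
    by (simp add: jet_action_def)
qed

lemma jet_group_representation:
  "group_representation (jet_group N :: ('n::finite, 'k::comm_ring_1) mps_map set monoid)
    (jet_ring N) (jet_action N)"
proof (intro group_representation.intro jet_group_group abelian_group_jet_ring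
    group_representation_axioms.intro)
  fix C :: "('n, 'k) mps_map set"
  assume "C \<in> carrier (jet_group N)"
  then obtain g where g: "g \<in> carrier vol_group" and C: "C = map_jet N g"
    by (auto simp: carrier_jet_group)
  interpret g: adic_endomorphism g
    using g by (rule vol_group_endomorphism)
  show "jet_action N C b \<in> carrier (jet_ring N)" if "b \<in> carrier (jet_ring N)" for b
    using that by (auto simp: C carrier_jet_ring jet_action_jet[OF g])
  show "jet_action N C (b \<oplus>\<^bsub>jet_ring N\<^esub> c) = jet_action N C b \<oplus>\<^bsub>jet_ring N\<^esub> jet_action N C c"
    if "b \<in> carrier (jet_ring N)" "c \<in> carrier (jet_ring N)" for b c
    using that by (auto simp: C carrier_jet_ring jet_action_jet[OF g] jet_add g.add)
  fix D :: "('n, 'k) mps_map set"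
  assume "D \<in> carrier (jet_group N)"
  then obtain h where h: "h \<in> carrier vol_group" and D: "D = map_jet N h"
    by (auto simp: carrier_jet_group)
  show "jet_action N (C \<otimes>\<^bsub>jet_group N\<^esub> D) b = jet_action N C (jet_action N D b)"
    if "b \<in> carrier (jet_ring N)" for b
    using that g h
    by (auto simp: C D carrier_jet_ring jet_group_mult jet_action_jet vol_group_comp_closed)
next
  show "jet_action N \<one>\<^bsub>jet_group N\<^esub> b = b" if "b \<in> carrier (jet_ring N)" for b
    using that by (auto simp: jet_group_one carrier_jet_ring jet_action_jet[OF vol_group_id_closed])
qed

lemma jet_filtered_representation:
  "filtered_representation (jet_group N) (jet_ring N) (jet_action N) (jet_filtration N)"
proof (intro filtered_representation.intro jet_group_representation
    filtered_representation_axioms.intro)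
  show "additive_subgroup (jet_filtration N q) (jet_ring N)" for q
    unfolding jet_filtration_eq
    by (rule additive_subgroupI, rule group_hom.subgroup_img_is_subgroup)
      (rule abelian_group_hom.a_group_hom[OF jet_hom],
        rule additive_subgroup.a_subgroup[OF ideal.axioms(1)[OF ideal_mps_max_pow]])
  show "jet_filtration N (Suc q) \<subseteq> jet_filtration N q" for q
    using mps_max_pow_antimono[of q "Suc q"] by (auto simp: jet_filtration_eq)
  show "jet_action N C b \<in> jet_filtration N q"
    if "C \<in> carrier (jet_group N)" "b \<in> jet_filtration N q" for C b q
    using that adic_endomorphism.max_pow[OF vol_group_endomorphism]
    by (auto simp: carrier_jet_group jet_filtration_eq jet_action_jet intro!: imageI)
qed

lemma jet_ideal_eq_shift_ideal:
  "jet_ideal N = filtered_representation.shift_ideal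
    (jet_group N) (jet_ring N) (jet_action N) (jet_filtration N)"
  by (simp add: fun_eq_iff jet_ideal_def jet_rep_def[abs_def] group_ring_action_def[abs_def]
      filtered_representation.shift_ideal_def[OF jet_filtered_representation])

lemma jet_ideal_filtration: "multiplicative_filtration (group_ring (jet_group N)) (jet_ideal N)"
  unfolding jet_ideal_eq_shift_ideal
  by (rule filtered_representation.shift_ideal_filtration[OF jet_filtered_representation])

lemma vol_subgroup_min_Suc_iff:
  fixes g :: "('n::finite, 'k::comm_ring_1) mps_map"
  assumes "g \<in> carrier vol_group"
  shows "g \<in> vol_subgroup (min (Suc a) N) \<longleftrightarrow>
    (\<forall>q. \<forall>f\<in>mps_max_pow q. g f - f \<in> mps_max_pow (min (q + a) N))"
proof (intro iffI allI ballI)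
  fix q and f :: "('n, 'k) mps"
  assume g: "g \<in> vol_subgroup (min (Suc a) N)" and f: "f \<in> mps_max_pow q"
  show "g f - f \<in> mps_max_pow (min (q + a) N)"
  proof (cases "Suc a \<le> N")
    case True
    then have "g f - f \<in> mps_max_pow (q + a)"
      using g f by (intro vol_subgroup_raises_max_pow) (simp_all add: min_def)
    then show ?thesis
      by (rule mps_max_pow_antimono[rotated]) simp
  next
    case False
    then have "g f - f \<in> mps_max_pow N"
      using g by (simp add: vol_subgroup_iff_diff)
    then show ?thesis
      by (rule mps_max_pow_antimono[rotated]) simp
  qed
next
  assume raises: "\<forall>q. \<forall>f\<in>mps_max_pow q. g f - f \<in> mps_max_pow (min (q + a) N)"
  have "g (mps_X j) - mps_X j \<in> mps_max_pow (min (Suc a) N)" for j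
    using raises[rule_format, OF mps_X_in_max_pow, of j] by simp
  then show "g \<in> vol_subgroup (min (Suc a) N)"
    using assms by (simp add: vol_subgroup_def)
qed

lemma dim_subgroup_jet_ideal: "dim_subgroup (jet_group N) (jet_ideal N a) = jet_weight N a"
proof -
  have "C \<in> dim_subgroup (jet_group N) (jet_ideal N a) \<longleftrightarrow> C \<in> jet_weight N a"
    if "C \<in> carrier (jet_group N)" for C
  proof -
    obtain g where g: "g \<in> carrier vol_group" and C: "C = map_jet N g"
      using \<open>C \<in> carrier (jet_group N)\<close> by (auto simp: carrier_jet_group)
    have "C \<in> dim_subgroup (jet_group N) (jet_ideal N a) \<longleftrightarrow>
        (\<forall>q. \<forall>f\<in>mps_max_pow q. jet N (g f - f) \<in> jet_filtration N (q + a))"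
      using that
      by (simp add: jet_ideal_eq_shift_ideal C jet_filtration_eq jet_action_jet[OF g] jet_minus
          filtered_representation.mem_dim_subgroup_shift_ideal_iff[OF jet_filtered_representation])
    also have "\<dots> \<longleftrightarrow> C \<in> jet_weight N a"
      by (simp add: jet_in_filtration_iff C jet_weight_def map_jet_in_jet_subgroup_iff[OF g]
          vol_subgroup_min_Suc_iff[OF g])
    finally show ?thesis .
  qed
  moreover have "jet_weight N a \<subseteq> carrier (jet_group N)"
    by (auto simp: jet_weight_def jet_subgroup_def carrier_jet_group vol_subgroup_def)
  ultimately show ?thesis
    by (auto simp: dim_subgroup_def)
qed

lemma jet_weighted_group: "weighted_group (jet_group N) (jet_weight N)"
proof (intro weighted_group.intro weighted_group_axioms.intro jet_group_group)
  show "jet_weight N b \<subseteq> carrier (jet_group N)" for b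
    unfolding dim_subgroup_jet_ideal[symmetric] by (auto simp: dim_subgroup_def)
qed

lemma jet_weight_1: "jet_weight N 1 = carrier (jet_group N)"
  by (simp add: jet_weight_def jet_subgroup_def carrier_jet_group vol_subgroup_le_2)

definition jet_reduction :: "nat \<Rightarrow> ('n::finite, 'k::comm_ring_1) mps set \<Rightarrow> ('n, 'k) mps set"
  where "jet_reduction N b = mps_max_pow N <+>\<^bsub>mps_ring\<^esub> b"

lemma jet_reduction_jet:
  assumes "N \<le> N'"
  shows "jet_reduction N (jet N' f) = jet N f"
proof (intro equalityI subsetI)
  fix h
  assume "h \<in> jet_reduction N (jet N' f)"
  then obtain u f' where "u \<in> mps_max_pow N" "f' - f \<in> mps_max_pow N'" "h = u + f'"
    by (auto simp: jet_reduction_def set_add_def' jet_eq)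
  then show "h \<in> jet N f"
    using mps_max_pow_add[OF _ mps_max_pow_antimono[OF assms], of u "f' - f"]
    by (simp add: jet_eq add_diff_eq)
next
  fix h
  assume "h \<in> jet N f"
  then have "h - f \<in> mps_max_pow N" "f \<in> jet N' f" "h = (h - f) + f"
    by (simp_all add: jet_eq)
  then show "h \<in> jet_reduction N (jet N' f)"
    unfolding jet_reduction_def set_add_def' type_ring_simps by blast
qed

lemma jet_reduction_hom:
  assumes "N \<le> N'"
  shows "abelian_group_hom (jet_ring N') (jet_ring N) (jet_reduction N)"
proof (intro abelian_group_homI abelian_group_jet_ring group_hom.intro group_hom_axioms.intro homI
    abelian_group.a_group)
  fix b c :: "('a, 'b) mps set"
  assume "b \<in> carrier (add_monoid (jet_ring N'))" "c \<in> carrier (add_monoid (jet_ring N'))"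
  then show "jet_reduction N b \<in> carrier (add_monoid (jet_ring N))"
    "jet_reduction N (b \<otimes>\<^bsub>add_monoid (jet_ring N')\<^esub> c) =
      jet_reduction N b \<otimes>\<^bsub>add_monoid (jet_ring N)\<^esub> jet_reduction N c"
    by (auto simp: carrier_jet_ring jet_reduction_jet[OF assms] jet_add)
qed

lemma group_ring_map_jet_ideal:
  assumes "N \<le> N'"
  shows "group_ring_map (jet_quotient N) ` jet_ideal N' a \<subseteq> jet_ideal N a"
  unfolding jet_ideal_eq_shift_ideal
proof (rule group_ring_map_shift_ideal[OF jet_filtered_representation jet_filtered_representation
      jet_reduction_hom[OF assms]])
  show "jet_quotient N ` carrier (jet_group N') \<subseteq> carrier (jet_group N)"
    using assms by (auto simp: carrier_jet_group jet_quotient_map_jet)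
  show "jet_reduction N (jet_action N' C b) = jet_action N (jet_quotient N C) (jet_reduction N b)"
    if "C \<in> carrier (jet_group N')" "b \<in> carrier (jet_ring N')" for C b
    using that assms
    by (auto simp: carrier_jet_group carrier_jet_ring jet_action_jet jet_quotient_map_jet
        jet_reduction_jet)
  show "jet_reduction N ` jet_filtration N' q = jet_filtration N q" for q
    by (simp add: jet_filtration_eq image_image jet_reduction_jet[OF assms])
qed

theorem theorem1p1:
  fixes N :: nat
    and T :: "nat \<Rightarrow> ('n::finite, 'p::prime_card mod_ring) mps_map set monoid"
    and H :: "nat \<Rightarrow> nat \<Rightarrow> ('n, 'p mod_ring) mps_map set set"
    and \<A> \<I> :: "nat \<Rightarrow> nat \<Rightarrow> (('n, 'p mod_ring) mps_map set \<Rightarrow>\<^sub>0 int) set"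
  defines "T \<equiv> jet_group"
    and "H \<equiv> jet_weight"
    and "\<A> \<equiv> (\<lambda>N. weighted_ideal (T N) (H N))"
    and "\<I> \<equiv> jet_ideal"
  assumes p: "CARD('p) \<ge> 5" and n: "CARD('n) \<ge> 3" and N: "N \<ge> 3"
  shows
    "(aug_ideal (T N) = \<A> N 1
      \<and> (\<forall>a\<ge>1. \<A> N (a + 1) \<subseteq> \<A> N a)
      \<and> (\<forall>a\<ge>1. ideal (\<A> N a) (group_ring (T N)))
      \<and> (\<forall>a\<ge>1. \<forall>b\<ge>1. \<A> N a \<cdot>\<^bsub>group_ring (T N)\<^esub> \<A> N b \<subseteq> \<A> N (a + b))
      \<and> (\<forall>a\<ge>1. dim_subgroup (T N) (\<A> N a) = H N a \<and> H N a = jet_subgroup N (a + 1)))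
   \<and> (aug_ideal (T N) = \<I> N 1
      \<and> (\<forall>a\<ge>1. \<I> N (a + 1) \<subseteq> \<I> N a)
      \<and> (\<forall>a\<ge>1. ideal (\<I> N a) (group_ring (T N)))
      \<and> (\<forall>a\<ge>1. \<forall>b\<ge>1. \<I> N a \<cdot>\<^bsub>group_ring (T N)\<^esub> \<I> N b \<subseteq> \<I> N (a + b))
      \<and> (\<forall>a\<ge>1. \<A> N a \<subseteq> \<I> N a \<and> dim_subgroup (T N) (\<I> N a) = jet_subgroup N (a + 1)))
   \<and> (\<forall>N'\<ge>N. \<forall>a\<ge>1. group_ring_map (jet_quotient N) ` \<I> N' a \<subseteq> \<I> N a)"
proof -
  interpret T: weighted_group "T N" "H N"
    unfolding T_def H_def by (rule jet_weighted_group)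
  have H_1: "H N 1 = carrier (T N)"
    unfolding T_def H_def by (rule jet_weight_1)
  interpret A: multiplicative_filtration "group_ring (T N)" "\<A> N"
    unfolding \<A>_def using H_1 by (rule T.weighted_ideal_filtration)
  interpret I: multiplicative_filtration "group_ring (T N)" "\<I> N"
    unfolding \<I>_def T_def by (rule jet_ideal_filtration)
  have dim_I: "dim_subgroup (T N) (\<I> N a) = H N a" for a
    unfolding T_def H_def \<I>_def by (rule dim_subgroup_jet_ideal)
  have dim_A: "dim_subgroup (T N) (\<A> N a) = H N a" if "1 \<le> a" for a
    unfolding \<A>_def using I.multiplicative_filtration_axioms dim_I that
    by (rule T.dim_subgroup_weighted_ideal_eq)
  have A_subset_I: "\<A> N a \<subseteq> \<I> N a" for a
    unfolding \<A>_def using I.multiplicative_filtration_axioms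
    by (rule T.weighted_ideal_least) (simp add: dim_I)
  have A_1: "aug_ideal (T N) = \<A> N 1"
    unfolding \<A>_def using T.weighted_ideal_1[OF H_1] ..
  have I_1: "aug_ideal (T N) = \<I> N 1"
    using A_1 A_subset_I[of 1] by (auto simp: \<I>_def T_def jet_ideal_def)
  have quotient: "group_ring_map (jet_quotient N) ` \<I> N' a \<subseteq> \<I> N a" if "N \<le> N'" for N' a
    unfolding \<I>_def using that by (rule group_ring_map_jet_ideal)
  show ?thesis
    using A_1 I_1 A.antimono I.antimono A.ideal I.ideal A.ideal_prod_subset I.ideal_prod_subset
      dim_A dim_I A_subset_I quotient by (simp add: H_def jet_weight_def)
qed

end
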